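(* Fix $\beta \in (0,1)$ and let $A$ be any positive real number. For large $T$ put $\sigma_A := 1 - A/\log\log T$. Then there is a constant $C>0$ (depending only on $A$ and $\beta$) such that for all sufficiently large $T$, $$\max_{T^{\beta} \leqslant t \leqslant T} \left(-\operatorname{Re} \frac{\zeta'}{\zeta}(\sigma_A + it)\right) \geqslant \frac{e^{A}-1}{A}\log\log T - C\,\frac{\log\log T}{\log\log\log T}.$$ In particular, for all sufficiently large $T$, $$\max_{T^{\beta} \leqslant t \leqslant T} \left| \frac{\zeta'}{\zeta}(\sigma_A + it)\right| \geqslant \frac{e^{A}-1}{A}\log\log T - C\,\frac{\log\log T}{\log\log\log T}.$$
   Context: $\zeta(s)$ denotes the Riemann zeta function and $s=\sigma+it$. The paper writes the error term as $O(\log_2 T/\log_3 T)$ with $\log_2 T=\log\log T$, $\log_3 T=\log\log\log T$. *)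

theory Defs
  imports "HOL-Complex_Analysis.Complex_Analysis"
begin

text \<open>The value at the pole \<open>s = 1\<close> is set to \<open>0\<close>, which makes the analytic
  continuation unique as a total function. That such a function exists is shown in
  \<open>ex1_zeta\<close> below.\<close>

definition zeta :: "complex \<Rightarrow> complex" where
  "zeta = (THE f. f holomorphic_on - {1} \<and>
     (\<forall>s. Re s > 1 \<longrightarrow> (\<lambda>n. 1 / of_nat (Suc n) powr s) sums f s) \<and> f 1 = 0)"

definition sigma_A :: "real \<Rightarrow> real \<Rightarrow> real" where
  "sigma_A A T = 1 - A / ln (ln T)"

text \<open>Existence of the continuation. Write \<open>zeta_rem K m s\<close> for the error in the binomial expansion
  of \<open>(m + 1) powr (1 - s)\<close> around \<open>m\<close> up to order \<open>K\<close>. Summing over \<open>m\<close> gives a formula for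
  \<open>(s - 1) * zeta s\<close> in terms of \<open>zeta (s + 1), \<dots>, zeta (s + K - 1)\<close> and a series that
  converges for \<open>Re s > 1 - K\<close>.\<close>

definition zeta_rem :: "nat \<Rightarrow> nat \<Rightarrow> complex \<Rightarrow> complex" where
  "zeta_rem K m s = of_nat (Suc m) powr (1 - s) - (\<Sum>k\<le>K. ((1 - s) gchoose k) * of_nat m powr (1 - s - of_nat k))"

lemma norm_gchoose_le:
  fixes w :: complex and r :: real
  assumes "norm w \<le> r"
  shows "norm (w gchoose k) \<le> (-1) ^ k * ((- r) gchoose k)"
proof -
  have r: "r \<ge> 0" using assms norm_ge_zero[of w] by linarith
  have "norm (w gchoose k) = (\<Prod>i=0..<k. norm (w - of_nat i)) / fact k"
    by (simp add: gbinomial_prod_rev norm_divide prod_norm[symmetric])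
  also have "\<dots> \<le> (\<Prod>i=0..<k. r + real i) / fact k"
  proof (intro divide_right_mono prod_mono conjI)
    fix i
    show "norm (w - of_nat i) \<le> r + real i"
      using norm_triangle_ineq4[of w "of_nat i"] assms by simp
  qed auto
  also have "(\<Prod>i=0..<k. r + real i) = (\<Prod>i=0..<k. (-1) * (- r - real i))"
    by (intro prod.cong) auto
  also have "\<dots> = (-1) ^ k * (\<Prod>i=0..<k. (- r - real i))"
    by (subst prod.distrib) simp
  finally show ?thesis by (simp add: gbinomial_prod_rev)
qed

lemma norm_zeta_rem_le:
  fixes r :: real
  obtains C where "\<And>m s. m \<ge> 2 \<Longrightarrow> norm (1 - s) \<le> r \<Longrightarrow> norm (zeta_rem K m s) \<le> C * real m powr (- Re s - real K)"
proof (cases "r \<ge> 0")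
  case False
  then have "\<not> norm (1 - s) \<le> r" for s :: complex using norm_ge_zero[of "1 - s"] by linarith
  then show ?thesis using that[of 0] by blast
next
  case True
  define b where "b j = (-1) ^ j * ((- r) gchoose j)" for j
  have "norm (0 :: complex) \<le> r" using True by simp
  from norm_gchoose_le[OF this] have b0: "b j \<ge> 0" for j
    unfolding b_def by (meson norm_ge_zero order_trans)
  have "(\<lambda>j. (- r gchoose j) * (- (1/2)) ^ j) sums (1 + (- (1/2))) powr (- r)"
    by (rule gen_binomial_real) simp
  then have "summable (\<lambda>j. (- r gchoose j) * (- (1/2)) ^ j)" by (rule sums_summable)
  also have "(\<lambda>j. (- r gchoose j) * (- (1/2)) ^ j) = (\<lambda>j. b j * (1/2) ^ j)"
    by (simp add: b_def fun_eq_iff power_minus[of "1/2"] mult_ac)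
  finally have sb: "summable (\<lambda>j. b j * (1/2) ^ j)" .
  then have sb': "summable (\<lambda>j. b (j + Suc K) * (1/2) ^ (j + Suc K))"
    by (subst summable_iff_shift)
  then have sb'': "summable (\<lambda>j. 2 ^ Suc K * (b (j + Suc K) * (1/2) ^ (j + Suc K)))"
    by (rule summable_mult)
  also have "(\<lambda>j. 2 ^ Suc K * (b (j + Suc K) * (1/2) ^ (j + Suc K))) = (\<lambda>j. b (j + Suc K) * (1/2) ^ j)"
    by (auto simp: fun_eq_iff power_add power_divide field_simps)
  finally have sc: "summable (\<lambda>j. b (j + Suc K) * (1/2) ^ j)" .
  define C where "C = (\<Sum>j. b (j + Suc K) * (1/2) ^ j)"
  show ?thesis
  proof (rule that[of C])
    fix m :: nat and s :: complex
    assume m: "m \<ge> 2" and s: "norm (1 - s) \<le> r"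
    define f where "f k = ((1 - s) gchoose k) * of_nat m powr (1 - s - of_nat k)" for k
    have "(\<lambda>k. ((1 - s) gchoose k) * of_real (real m) powr (1 - s - of_nat k) * of_real 1 ^ k)
             sums of_real (real m + 1) powr (1 - s)"
      by (rule gen_binomial_complex'') (use m in auto)
    then have "f sums (of_nat (Suc m) powr (1 - s))"
      by (simp add: f_def[abs_def] add_ac)
    then have "(\<lambda>k. f (k + Suc K)) sums (of_nat (Suc m) powr (1 - s) - sum f {..<Suc K})"
      by (subst sums_iff_shift')
    then have sums: "(\<lambda>k. f (k + Suc K)) sums zeta_rem K m s"
      by (simp add: zeta_rem_def f_def lessThan_Suc_atMost)
    have le: "norm (f (k + Suc K)) \<le> b (k + Suc K) * (1/2) ^ k * real m powr (- Re s - real K)" for k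
    proof -
      have "norm (f (k + Suc K)) = norm ((1 - s) gchoose (k + Suc K)) * real m powr (- Re s - real K - real k)"
        by (simp add: f_def norm_mult norm_powr_real_powr algebra_simps)
      also have "\<dots> = norm ((1 - s) gchoose (k + Suc K)) * ((1 / real m) ^ k * real m powr (- Re s - real K))"
        using m by (simp add: powr_diff powr_realpow power_divide)
      also have "\<dots> \<le> b (k + Suc K) * ((1 / 2) ^ k * real m powr (- Re s - real K))"
        using norm_gchoose_le[OF s, of "k + Suc K"] m b0[of "k + Suc K"]
        by (intro mult_mono power_mono) (auto simp: b_def field_simps)
      finally show ?thesis by (simp add: mult_ac)
    qed
    have "norm (zeta_rem K m s) = norm (\<Sum>k. f (k + Suc K))"
      using sums by (simp add: sums_iff)
    also have "\<dots> \<le> (\<Sum>k. b (k + Suc K) * (1/2) ^ k * real m powr (- Re s - real K))"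
      by (rule norm_suminf_le[OF le]) (intro summable_mult2 sc)
    also have "\<dots> = C * real m powr (- Re s - real K)"
      unfolding C_def using sc by (rule suminf_mult2[symmetric])
    finally show "norm (zeta_rem K m s) \<le> C * real m powr (- Re s - real K)" .
  qed
qed

lemma holomorphic_on_gchoose: "f holomorphic_on A \<Longrightarrow> (\<lambda>s. (f s :: complex) gchoose k) holomorphic_on A"
  unfolding gbinomial_prod_rev by (auto intro!: holomorphic_intros)

lemma holomorphic_sum_zeta_rem:
  "(\<forall>s. Re s > 1 - real K \<longrightarrow> summable (\<lambda>n. zeta_rem K (Suc n) s)) \<and>
   (\<lambda>s. \<Sum>n. zeta_rem K (Suc n) s) holomorphic_on {s. Re s > 1 - real K}"
proof -
  have ex: "\<exists>d>0. cball s0 d \<subseteq> {s. Re s > 1 - real K} \<and>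
     uniform_limit (cball s0 d) (\<lambda>N s. \<Sum>n<N. zeta_rem K (Suc n) s) (\<lambda>s. \<Sum>n. zeta_rem K (Suc n) s) sequentially \<and>
     summable (\<lambda>n. zeta_rem K (Suc n) s0)"
    if s0: "Re s0 > 1 - real K" for s0
  proof -
    define d where "d = (Re s0 - (1 - real K)) / 2"
    have d: "d > 0" using s0 by (simp add: d_def)
    obtain C where C: "\<And>m s. m \<ge> 2 \<Longrightarrow> norm (1 - s) \<le> norm (1 - s0) + d \<Longrightarrow> norm (zeta_rem K m s) \<le> C * real m powr (- Re s - real K)"
      using norm_zeta_rem_le by blast
    have re: "Re s \<ge> 1 - real K + d" if "s \<in> cball s0 d" for s
    proof -
      have "\<bar>Re (s0 - s)\<bar> \<le> d" using that abs_Re_le_cmod[of "s0 - s"] by (simp add: dist_norm)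
      then have "Re s0 - Re s \<le> d" by simp
      then show ?thesis unfolding d_def by (simp add: field_simps)
    qed
    have bd: "norm (zeta_rem K m s) \<le> \<bar>C\<bar> * real m powr (- 1 - d)" if m: "m \<ge> 2" and s: "s \<in> cball s0 d" for m s
    proof -
      have "norm (1 - s) \<le> norm (1 - s0) + d"
        using norm_triangle_ineq[of "1 - s0" "s0 - s"] s by (simp add: dist_norm)
      from C[OF m this] have "norm (zeta_rem K m s) \<le> C * real m powr (- Re s - real K)" .
      also have "\<dots> \<le> \<bar>C\<bar> * real m powr (- 1 - d)"
        using re[OF s] m by (intro mult_mono powr_mono) auto
      finally show ?thesis .
    qed
    have sm: "summable (\<lambda>n. \<bar>C\<bar> * real (Suc n) powr (- 1 - d))"
      using d by (intro summable_mult) (subst summable_Suc_iff, simp add: summable_real_powr_iff)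
    have ev: "eventually (\<lambda>n. \<forall>s\<in>cball s0 d. norm (zeta_rem K (Suc n) s) \<le> \<bar>C\<bar> * real (Suc n) powr (- 1 - d)) sequentially"
      using eventually_ge_at_top[of 1] by eventually_elim (intro ballI bd, auto)
    have "summable (\<lambda>n. zeta_rem K (Suc n) s0)"
      by (rule summable_comparison_test_ev[OF _ sm], rule eventually_mono[OF ev]) (use d in auto)
    moreover have "cball s0 d \<subseteq> {s. Re s > 1 - real K}" using re d by force
    ultimately show ?thesis using d Weierstrass_m_test_ev[OF ev sm] by blast
  qed
  have "(\<lambda>s. \<Sum>n. zeta_rem K (Suc n) s) holomorphic_on {s. Re s > 1 - real K}"
  proof (rule holomorphic_uniform_sequence[where f = "\<lambda>N s. \<Sum>n<N. zeta_rem K (Suc n) s"])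
    show "open {s. Re s > 1 - real K}" by (rule open_halfspace_Re_gt)
    show "(\<lambda>s. \<Sum>n<N. zeta_rem K (Suc n) s) holomorphic_on {s. Re s > 1 - real K}" for N
      unfolding zeta_rem_def by (auto intro!: holomorphic_intros holomorphic_on_gchoose)
  qed (use ex in auto)
  then show ?thesis using ex by auto
qed

definition zeta_series :: "complex \<Rightarrow> complex" where "zeta_series s = (\<Sum>n. 1 / of_nat (Suc n) powr s)"

lemma sums_zeta_series: assumes "Re s > 1" shows "(\<lambda>n. 1 / of_nat (Suc n) powr s) sums zeta_series s"
proof -
  have "summable (\<lambda>n. real (Suc n) powr (- Re s))"
    using assms by (subst summable_Suc_iff, simp add: summable_real_powr_iff)
  moreover have "norm (1 / of_nat (Suc n) powr s) = real (Suc n) powr (- Re s)" for n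
    by (simp add: norm_divide norm_powr_real_powr powr_minus_divide del: of_nat_Suc)
  ultimately have "summable (\<lambda>n. norm (1 / of_nat (Suc n) powr s))"
    by (simp only:)
  then have "summable (\<lambda>n. 1 / of_nat (Suc n) powr s)"
    by (rule summable_norm_cancel)
  then show ?thesis unfolding zeta_series_def by (rule summable_sums)
qed

lemma zeta_series_rec:
  assumes s: "Re s > 1"
  shows "(s - 1) * zeta_series s = 1 - (\<Sum>k\<in>{2..Suc K}. ((1 - s) gchoose (k - 1)) / of_nat k * ((s + of_nat k - 2) * zeta_series (s + of_nat k - 1)))
     + (\<Sum>n. zeta_rem (Suc K) (Suc n) s)"
proof -
  let ?K = "Suc K"
  have aux: "(s - 1) * z = 1 - q + a" if "a + ((1 - s) * z + p) = - 1" "p = - q" for a z p q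
    using that by algebra
  have sumR: "summable (\<lambda>n. zeta_rem ?K (Suc n) s)"
    using holomorphic_sum_zeta_rem[of ?K] s by auto
  have Zk: "(\<lambda>n. of_nat (Suc n) powr (1 - s - of_nat k)) sums zeta_series (s + of_nat k - 1)" if "k \<ge> 1" for k
  proof -
    have "Re (s + of_nat k - 1) > 1" using s that by simp
    from sums_zeta_series[OF this] show ?thesis
      by (simp add: powr_minus_divide[symmetric] algebra_simps del: of_nat_Suc)
  qed
  have "(\<lambda>n. of_nat (Suc n) powr (1 - s)) \<longlonglongrightarrow> (0::complex)"
  proof (rule tendsto_norm_zero_cancel)
    have "(\<lambda>n. real (Suc n) powr (1 - Re s)) \<longlonglongrightarrow> 0"
      using s by real_asymp
    then show "(\<lambda>n. norm (of_nat (Suc n) powr (1 - s))) \<longlonglongrightarrow> 0"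
      by (simp add: norm_powr_real_powr del: of_nat_Suc)
  qed
  from telescope_sums[OF this]
  have t: "(\<lambda>n. of_nat (Suc (Suc n)) powr (1 - s) - of_nat (Suc n) powr (1 - s)) sums (0 - 1)"
    by simp
  have "(\<lambda>n. zeta_rem ?K (Suc n) s + (\<Sum>k\<in>{1..?K}. ((1 - s) gchoose k) * of_nat (Suc n) powr (1 - s - of_nat k)))
     sums ((\<Sum>n. zeta_rem ?K (Suc n) s) + (\<Sum>k\<in>{1..?K}. ((1 - s) gchoose k) * zeta_series (s + of_nat k - 1)))"
    using sumR by (intro sums_add summable_sums sums_sum sums_mult Zk) auto
  also have "(\<lambda>n. zeta_rem ?K (Suc n) s + (\<Sum>k\<in>{1..?K}. ((1 - s) gchoose k) * of_nat (Suc n) powr (1 - s - of_nat k)))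
      = (\<lambda>n. of_nat (Suc (Suc n)) powr (1 - s) - of_nat (Suc n) powr (1 - s))"
  proof
    fix n
    have "{..?K} = insert 0 {1..?K}" by auto
    then show "zeta_rem ?K (Suc n) s + (\<Sum>k\<in>{1..?K}. ((1 - s) gchoose k) * of_nat (Suc n) powr (1 - s - of_nat k))
      = of_nat (Suc (Suc n)) powr (1 - s) - of_nat (Suc n) powr (1 - s)"
      unfolding zeta_rem_def by (simp del: of_nat_Suc sum.cl_ivl_Suc)
  qed
  finally have "(\<Sum>n. zeta_rem ?K (Suc n) s) + (\<Sum>k\<in>{1..?K}. ((1 - s) gchoose k) * zeta_series (s + of_nat k - 1)) = - 1"
    using t sums_unique2 by fastforce
  moreover have "{1..?K} = insert 1 {2..?K}" by auto
  ultimately have eq: "(\<Sum>n. zeta_rem ?K (Suc n) s) + ((1 - s) * zeta_series s + (\<Sum>k\<in>{2..?K}. ((1 - s) gchoose k) * zeta_series (s + of_nat k - 1))) = - 1"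
    by (simp del: sum.cl_ivl_Suc)
  have "(\<Sum>k\<in>{2..?K}. ((1 - s) gchoose k) * zeta_series (s + of_nat k - 1)) =
        - (\<Sum>k\<in>{2..?K}. ((1 - s) gchoose (k - 1)) / of_nat k * ((s + of_nat k - 2) * zeta_series (s + of_nat k - 1)))"
    unfolding sum_negf[symmetric]
  proof (intro sum.cong refl)
    fix k assume "k \<in> {2..?K}"
    then obtain j where j: "k = Suc j" by (cases k) auto
    have "(1 - s) * ((1 - s) gchoose j) = of_nat j * ((1 - s) gchoose j) + of_nat (Suc j) * ((1 - s) gchoose (Suc j))"
      by (rule gbinomial_mult_1)
    then have "((1 - s) gchoose k) * of_nat k = - (((1 - s) gchoose j) * (s + of_nat k - 2))"
      unfolding j by (simp add: algebra_simps)
    then have "((1 - s) gchoose k) = - (((1 - s) gchoose j) * (s + of_nat k - 2)) / of_nat k"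
      by (subst nonzero_eq_divide_eq) (use j in \<open>auto simp del: of_nat_Suc\<close>)
    then show "((1 - s) gchoose k) * zeta_series (s + of_nat k - 1) =
       - (((1 - s) gchoose (k - 1)) / of_nat k * ((s + of_nat k - 2) * zeta_series (s + of_nat k - 1)))"
      unfolding j by simp
  qed
  from aux[OF eq this] show ?thesis .
qed

lemma zeta_continuation_halfplane:
  "\<exists>h. h holomorphic_on {s. Re s > - real K} \<and> (\<forall>s. Re s > 1 \<longrightarrow> h s = (s - 1) * zeta_series s)"
proof -
  have step: "\<exists>h. h holomorphic_on {s. Re s > - real K} \<and> (\<forall>s. Re s > 1 \<longrightarrow> h s = (s - 1) * zeta_series s)"
    if g: "K > 0 \<Longrightarrow> g holomorphic_on {s. Re s > 1 - real K}" "\<And>s. Re s > 1 \<Longrightarrow> g s = (s - 1) * zeta_series s" for K g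
  proof (intro exI conjI allI impI)
    let ?h = "\<lambda>s. 1 - (\<Sum>k\<in>{2..Suc K}. ((1 - s) gchoose (k - 1)) / of_nat k * g (s + of_nat k - 1))
       + (\<Sum>n. zeta_rem (Suc K) (Suc n) s)"
    have "(\<lambda>s. g (s + of_nat k - 1)) holomorphic_on {s. Re s > - real K}" if "k \<in> {2..Suc K}" for k
    proof -
      have "K > 0" using that by auto
      have "(g \<circ> (\<lambda>s. s + of_nat k - 1)) holomorphic_on {s. Re s > - real K}"
        by (rule holomorphic_on_compose_gen[OF _ g(1)[OF \<open>K > 0\<close>]])
           (use that in \<open>auto intro!: holomorphic_intros\<close>)
      then show ?thesis by (simp add: o_def)
    qed
    then show "?h holomorphic_on {s. Re s > - real K}"
      using holomorphic_sum_zeta_rem[of "Suc K"] by (intro holomorphic_intros holomorphic_on_gchoose) auto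
    fix s :: complex assume s: "Re s > 1"
    have "(\<Sum>k\<in>{2..Suc K}. ((1 - s) gchoose (k - 1)) / of_nat k * g (s + of_nat k - 1)) =
      (\<Sum>k\<in>{2..Suc K}. ((1 - s) gchoose (k - 1)) / of_nat k * ((s + of_nat k - 2) * zeta_series (s + of_nat k - 1)))"
    proof (intro sum.cong refl)
      fix k assume "k \<in> {2..Suc K}"
      then have "Re (s + of_nat k - 1) > 1" using s by simp
      from g(2)[OF this] show "((1 - s) gchoose (k - 1)) / of_nat k * g (s + of_nat k - 1) =
          ((1 - s) gchoose (k - 1)) / of_nat k * ((s + of_nat k - 2) * zeta_series (s + of_nat k - 1))"
        by simp
    qed
    note eq = this
    show "?h s = (s - 1) * zeta_series s" unfolding zeta_series_rec[OF s, of K] eq by (rule refl)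
  qed
  show ?thesis
  proof (induction K)
    case 0
    show ?case by (rule step[where g = "\<lambda>s. (s - 1) * zeta_series s"]) auto
  next
    case (Suc K)
    then obtain g where "g holomorphic_on {s. Re s > - real K}" "\<forall>s. Re s > 1 \<longrightarrow> g s = (s - 1) * zeta_series s" by blast
    then show ?case by (intro step[of "Suc K" g]) auto
  qed
qed

lemma zeta_continuation:
  "\<exists>h. h holomorphic_on UNIV \<and> (\<forall>s. Re s > 1 \<longrightarrow> h s = (s - 1) * zeta_series s)"
proof -
  obtain h where h: "\<And>K. h K holomorphic_on {s. Re s > - real K}" "\<And>K s. Re s > 1 \<Longrightarrow> h K s = (s - 1) * zeta_series s"
    using zeta_continuation_halfplane by metis
  have agree: "h K s = h L s" if "K \<le> L" "Re s > - real K" for K L s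
  proof (rule analytic_continuation_open[of "{s. Re s > 1}" "{s. Re s > - real K}" "h K" "h L"])
    show "h L holomorphic_on {s. Re s > - real K}"
      by (rule holomorphic_on_subset[OF h(1)]) (use that in auto)
    show "{s. Re s > 1} \<noteq> {}" by (auto intro: exI[of _ 2])
    show "connected {s. Re s > - real K}"
      by (intro convex_connected convex_halfspace_Re_gt)
  qed (use that h in \<open>auto intro: open_halfspace_Re_gt\<close>)
  define N where "N s = nat \<lceil>\<bar>Re s\<bar>\<rceil> + 1" for s :: complex
  have N: "Re s > - real (N s)" for s unfolding N_def by linarith
  define H where "H s = h (N s) s" for s
  have H: "H s = h K s" if "Re s > - real K" for K s
  proof (cases "K \<le> N s")
    case True
    from agree[OF this that] show ?thesis unfolding H_def by (rule sym)
  next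
    case False
    then have "N s \<le> K" by simp
    from agree[OF this N] show ?thesis unfolding H_def .
  qed
  have "H holomorphic_on (\<Union>K\<in>UNIV. {s. Re s > - real K})"
  proof (rule holomorphic_on_UN_open)
    show "H holomorphic_on {s. Re s > - real K}" for K
      by (rule holomorphic_transform[OF h(1)[of K]]) (simp add: H)
  qed (rule open_halfspace_Re_gt)
  moreover have "(\<Union>K\<in>UNIV. {s. Re s > - real K}) = UNIV" using N by blast
  moreover have "H s = (s - 1) * zeta_series s" if "Re s > 1" for s
    using h(2)[OF that] by (simp add: H_def)
  ultimately show ?thesis by metis
qed

lemma ex1_zeta:
  "\<exists>!f. f holomorphic_on - {1} \<and>
     (\<forall>s. Re s > 1 \<longrightarrow> (\<lambda>n. 1 / of_nat (Suc n) powr s) sums f s) \<and> f 1 = (0::complex)"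
proof -
  obtain h where h: "h holomorphic_on UNIV" "\<And>s. Re s > 1 \<Longrightarrow> h s = (s - 1) * zeta_series s"
    using zeta_continuation by blast
  define f where "f s = h s / (s - 1)" for s
  show ?thesis
  proof (rule ex1I[of _ f], intro conjI allI impI)
    show "f holomorphic_on - {1}"
      unfolding f_def by (intro holomorphic_intros holomorphic_on_subset[OF h(1)]) auto
    show "f 1 = 0" by (simp add: f_def)
    fix s :: complex assume s: "Re s > 1"
    then have "s \<noteq> 1" by auto
    then have "f s = zeta_series s" by (simp add: f_def h(2)[OF s])
    then show "(\<lambda>n. 1 / of_nat (Suc n) powr s) sums f s" using sums_zeta_series[OF s] by simp
  next
    fix g assume g: "g holomorphic_on - {1} \<and>
      (\<forall>s. Re s > 1 \<longrightarrow> (\<lambda>n. 1 / of_nat (Suc n) powr s) sums g s) \<and> g 1 = (0::complex)"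
    have fhol: "f holomorphic_on - {1}"
      unfolding f_def by (intro holomorphic_intros holomorphic_on_subset[OF h(1)]) auto
    have eq: "g s = f s" if s: "Re s > 1" for s
    proof -
      have "s \<noteq> 1" using s by auto
      then have "f s = zeta_series s" by (simp add: f_def h(2)[OF s])
      moreover have "(\<lambda>n. 1 / of_nat (Suc n) powr s) sums g s" using g s by blast
      ultimately show ?thesis using sums_unique2[OF _ sums_zeta_series[OF s]] by simp
    qed
    have "g s = f s" if "s \<noteq> 1" for s
    proof (rule analytic_continuation_open[of "{s. Re s > 1}" "- {1}" g f])
      show "{s. Re s > 1} \<noteq> {}" by (auto intro: exI[of _ 2])
      show "connected (- {1 :: complex})"
        by (rule connected_punctured_universe) simp
    qed (use that g fhol eq in \<open>auto intro: open_halfspace_Re_gt\<close>)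
    moreover have "g 1 = f 1" using g by (simp add: f_def)
    ultimately show "g = f" by (metis ext)
  qed
qed

lemma zeta_holomorphic: "zeta holomorphic_on - {1}"
  by (rule conjunct1[OF theI'[OF ex1_zeta, folded zeta_def]])

lemma zeta_sums: "Re s > 1 \<Longrightarrow> (\<lambda>n. 1 / of_nat (Suc n) powr s) sums zeta s"
  by (rule conjunct1[OF conjunct2[OF theI'[OF ex1_zeta, folded zeta_def]], rule_format])

lemma zeta_1: "zeta 1 = 0"
  by (rule conjunct2[OF conjunct2[OF theI'[OF ex1_zeta, folded zeta_def]]])

end

theory Submission
  imports Defs
begin

text \<open>Suppose that \<open>- Re (zeta'/zeta) < M\<close> on the line \<open>Re s = \<sigma>\<close> for \<open>T/2 \<le> t \<le> T\<close>. Multiplying by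
  \<open>\<bar>zeta\<bar>\<^sup>2 \<bar>R\<bar>\<^sup>2\<close> for a Dirichlet polynomial \<open>R\<close> and integrating gives
  \<open>\<integral> - Re (zeta' cnj zeta) \<bar>R\<bar>\<^sup>2 \<le> M \<integral> \<bar>zeta\<bar>\<^sup>2 \<bar>R\<bar>\<^sup>2\<close>, in which zeros of \<open>zeta\<close> play no role, so that
  no zero-density estimate is needed. Up to negligible errors \<open>zeta\<close> may be replaced by its partial
  sum over \<open>n \<le> T\<^sup>2\<close> and both integrals by their diagonal terms.

  Take \<open>Q = (Y!) ^ E\<close> with \<open>E\<close> about \<open>log log T\<close> and \<open>Y\<close> about \<open>log T / (log log T) ^ 3\<close>, so that
  \<open>Q \<le> T powr (1/100)\<close>, and let the coefficients of \<open>R\<close> be those \<open>r d\<close>, \<open>d dvd Q\<close>, for which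
  \<open>(\<Sum>d | d dvd n. r d) = n powr \<sigma>\<close>; they are nonnegative. Then \<open>zeta R\<close> has \<open>n\<close>-th coefficient
  \<open>n powr \<sigma>\<close> for \<open>n dvd Q\<close>, so each divisor of \<open>Q\<close> contributes \<open>1\<close> to the right-hand diagonal, and
  the other \<open>n\<close> together contribute a proportion \<open>O(1/E)\<close>. On the left, a prime \<open>p \<le> Y\<close> contributes
  \<open>log p / p powr \<sigma>\<close> for each of the many divisors of \<open>Q\<close> divisible by \<open>p\<close>. Hence \<open>M\<close> is at least about
  \<open>\<Sum>p\<le>Y. log p / p powr \<sigma>\<close>, which Mertens' theorem evaluates.\<close>

section \<open>Approximation of zeta by partial sums\<close>

text \<open>Remainder of the first-order Taylor expansion of \<open>x powr (1 - s)\<close> on the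
  segment from \<open>m\<close> to \<open>m + 1\<close>; \<open>f 0\<close>, \<open>f 1\<close>,
  \<open>f 2\<close> are the function and its first two derivatives. Unlike the constant in
  \<open>norm_zeta_rem_le\<close>, the bound is explicit in \<open>s\<close>, which matters because
  \<open>norm s\<close> grows with \<open>T\<close>.\<close>

lemma norm_zeta_rem_1_le:
  assumes m: "m \<ge> 1" and s: "Re s > 0"
  shows "norm (zeta_rem 1 m s) \<le> norm s * norm (1 - s) * real m powr (- Re s - 1)"
proof -
  define f where "f i x = (if i = 0 then x powr (1 - s) else if i = 1 then (1 - s) * x powr (- s)
      else (1 - s) * (- s) * x powr (- s - 1))" for i :: nat and x :: complex
  let ?I = "closed_segment (of_nat m) (of_nat m + 1 :: complex)"
  have seg: "Im x = 0 \<and> Re x \<ge> real m \<and> x \<in> \<real> \<and> x \<notin> \<real>\<^sub>\<le>\<^sub>0 \<and> x \<noteq> 0" if x: "x \<in> ?I" for x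
  proof -
    from x obtain u where u: "0 \<le> u" "u \<le> 1" "x = (1 - u) *\<^sub>R of_nat m + u *\<^sub>R (of_nat m + 1)"
      by (auto simp: closed_segment_def)
    have "x = of_real (real m + u)" using u(3) by (simp add: scaleR_conv_of_real algebra_simps)
    moreover have "real m + u > 0" using u m by simp
    ultimately show ?thesis using u by (auto simp: complex_nonpos_Reals_iff simp del: of_real_add)
  qed
  have "norm (f 0 (of_nat m + 1) - (\<Sum>i\<le>1. f i (of_nat m) * (of_nat m + 1 - of_nat m) ^ i / fact i))
      \<le> (norm s * norm (1 - s) * real m powr (- Re s - 1)) * norm (of_nat m + 1 - of_nat m :: complex) ^ (Suc 1) / fact 1"
  proof (rule field_Taylor[of ?I 1 f])
    fix i x assume x: "x \<in> ?I" and i: "i \<le> (1::nat)"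
    show "(f i has_field_derivative f (Suc i) x) (at x within ?I)"
    proof (cases "i = 0")
      case True
      then show ?thesis using seg[OF x] unfolding f_def
        by (auto intro!: derivative_eq_intros simp: diff_diff_eq)
    next
      case False
      then have "i = 1" using i by simp
      then show ?thesis using seg[OF x] unfolding f_def
        by (auto intro!: derivative_eq_intros)
    qed
  next
    fix x assume x: "x \<in> ?I"
    have "norm (f (Suc 1) x) = norm s * norm (1 - s) * Re x powr (- Re s - 1)"
      using seg[OF x] m by (simp add: f_def norm_mult norm_powr_real_powr mult_ac)
    also have "\<dots> \<le> norm s * norm (1 - s) * real m powr (- Re s - 1)"
      using seg[OF x] m s by (intro mult_left_mono powr_mono2') auto
    finally show "norm (f (Suc 1) x) \<le> norm s * norm (1 - s) * real m powr (- Re s - 1)" .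
  qed auto
  then show ?thesis
    by (simp add: f_def zeta_rem_def add_ac algebra_simps)
qed

text \<open>For \<open>Re s > 1\<close> this is \<open>zeta_series_rec\<close> with
  \<open>K = 0\<close>, where the sum over \<open>k\<close> is empty. Both sides are holomorphic on
  the connected set \<open>A\<close>, so the identity persists there.\<close>

lemma zeta_eq_rem_sum:
  assumes "Re s > 0" "s \<noteq> 1"
  shows "(s - 1) * zeta s = 1 + (\<Sum>n. zeta_rem 1 (Suc n) s)"
proof -
  let ?H = "\<lambda>s. 1 + (\<Sum>n. zeta_rem 1 (Suc n) s)"
  define A where "A = {s. Re s > 0} - {1 :: complex}"
  have opn: "open A" unfolding A_def by (intro open_Diff open_halfspace_Re_gt) auto
  show ?thesis
  proof (rule analytic_continuation_open[of "{s. Re s > 1}" A "\<lambda>s. (s - 1) * zeta s" ?H])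
    show "{s. Re s > 1} \<noteq> {}" by (auto intro: exI[of _ 2])
    show "connected A" unfolding A_def
      by (intro connected_open_delete convex_connected convex_halfspace_Re_gt open_halfspace_Re_gt) simp
    show "(\<lambda>s. (s - 1) * zeta s) holomorphic_on A"
      by (intro holomorphic_intros holomorphic_on_subset[OF zeta_holomorphic]) (auto simp: A_def)
    show "?H holomorphic_on A"
      using holomorphic_sum_zeta_rem[of 1]
      by (intro holomorphic_intros) (auto simp: A_def intro: holomorphic_on_subset)
    show "(s - 1) * zeta s = ?H s" if "s \<in> {s. Re s > 1}" for s
    proof -
      have s: "Re s > 1" using that by simp
      have "zeta s = zeta_series s" using sums_unique2[OF zeta_sums[OF s] sums_zeta_series[OF s]] .
      then show ?thesis using zeta_series_rec[OF s, of 0] by simp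
    qed
  qed (use assms opn in \<open>auto simp: A_def intro: open_halfspace_Re_gt\<close>)
qed

text \<open>Mean value theorem for \<open>- (x powr (- c))\<close>. The right-hand side telescopes,
  which gives \<open>powr_tail_sums\<close>.\<close>

lemma powr_telescope_le:
  fixes x :: real
  assumes x: "x > 0" and c: "c > 0"
  shows "(x + 1) powr (- c - 1) \<le> (x powr (- c) - (x + 1) powr (- c)) / c"
proof -
  have "\<exists>z. x < z \<and> z < x + 1 \<and> - ((x + 1) powr (- c)) - - (x powr (- c)) = (x + 1 - x) * (c * z powr (- c - 1))"
    using x by (intro MVT2) (auto intro!: derivative_eq_intros)
  then obtain z where z: "x < z" "z < x + 1" and "x powr (- c) - (x + 1) powr (- c) = c * z powr (- c - 1)"
    by auto
  then have "(x powr (- c) - (x + 1) powr (- c)) / c = z powr (- c - 1)" using c by simp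
  moreover have "(x + 1) powr (- c - 1) \<le> z powr (- c - 1)"
    using z x c by (intro powr_mono2') auto
  ultimately show ?thesis by simp
qed

lemma powr_tail_sums:
  fixes X :: nat
  assumes X: "X \<ge> 1" and c: "c > 0"
  shows "summable (\<lambda>n. real (n + Suc X) powr (- c - 1))"
    and "(\<Sum>n. real (n + Suc X) powr (- c - 1)) \<le> real X powr (- c) / c"
proof -
  have "(\<lambda>n. real (n + X) powr (- c)) \<longlonglongrightarrow> 0" using c by real_asymp
  from telescope_sums'[OF this]
  have "(\<lambda>n. real (n + X) powr (- c) - real (Suc n + X) powr (- c)) sums (real X powr (- c))" by simp
  from sums_divide[OF this, of c]
  have t: "(\<lambda>n. (real (n + X) powr (- c) - real (Suc n + X) powr (- c)) / c) sums (real X powr (- c) / c)" .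
  have le: "real (n + Suc X) powr (- c - 1) \<le> (real (n + X) powr (- c) - real (Suc n + X) powr (- c)) / c" for n
    using powr_telescope_le[of "real (n + X)" c] X c by (simp add: add_ac)
  show s: "summable (\<lambda>n. real (n + Suc X) powr (- c - 1))"
    by (rule summable_comparison_test'[OF sums_summable[OF t], of 0]) (use le in auto)
  show "(\<Sum>n. real (n + Suc X) powr (- c - 1)) \<le> real X powr (- c) / c"
    using suminf_le[OF le s sums_summable[OF t]] sums_unique[OF t] by simp
qed

definition zeta_sum :: "nat \<Rightarrow> complex \<Rightarrow> complex" where
  "zeta_sum X s = (\<Sum>n\<in>{1..X}. of_nat n powr (- s))"

text \<open>In the series of \<open>zeta_eq_rem_sum\<close> the first \<open>X\<close> terms
  telescope to a multiple of \<open>zeta_sum X s\<close> and a boundary term. Divided by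
  \<open>s - 1\<close>, the boundary term becomes the first error and the tail of the series the
  second.\<close>

lemma norm_zeta_minus_sum_le:
  assumes X: "X \<ge> 1" and s: "Re s > 0" "s \<noteq> 1"
  shows "norm (zeta s - zeta_sum X s) \<le> real (Suc X) powr (1 - Re s) / norm (s - 1) + norm s * real X powr (- Re s) / Re s"
proof -
  let ?r = "\<lambda>n. zeta_rem 1 n s"
  have sm: "summable (\<lambda>n. ?r (Suc n))" using holomorphic_sum_zeta_rem[of 1] s by auto
  have head: "(\<Sum>n<X. ?r (Suc n)) = of_nat (Suc X) powr (1 - s) - 1 - (1 - s) * zeta_sum X s"
  proof (induction X)
    case 0
    show ?case by (simp add: zeta_sum_def)
  next
    case (Suc X)
    have "?r (Suc X) = of_nat (Suc (Suc X)) powr (1 - s) - of_nat (Suc X) powr (1 - s) - (1 - s) * of_nat (Suc X) powr (- s)"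
      by (simp add: zeta_rem_def algebra_simps)
    moreover have "zeta_sum (Suc X) s = zeta_sum X s + of_nat (Suc X) powr (- s)"
      by (simp add: zeta_sum_def del: of_nat_Suc)
    ultimately show ?case using Suc.IH
      by (simp only: sum.lessThan_Suc) (simp add: ring_distribs del: of_nat_Suc)
  qed
  define tail where "tail = (\<Sum>n. ?r (n + Suc X))"
  have "(\<Sum>n. ?r (Suc n)) = tail + (\<Sum>n<X. ?r (Suc n))"
    using suminf_split_initial_segment[OF sm, of X] by (simp add: tail_def)
  then have "(s - 1) * (zeta s - zeta_sum X s) = of_nat (Suc X) powr (1 - s) + tail"
    using zeta_eq_rem_sum[OF s] head by (simp add: algebra_simps)
  then have eq: "zeta s - zeta_sum X s = (of_nat (Suc X) powr (1 - s) + tail) / (s - 1)"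
    using s by (simp add: field_simps)
  have "norm tail \<le> (\<Sum>n. norm s * norm (1 - s) * real (n + Suc X) powr (- Re s - 1))"
    unfolding tail_def
    by (rule norm_suminf_le[OF norm_zeta_rem_1_le]) (use s X powr_tail_sums(1)[of X "Re s"] in \<open>auto intro!: summable_mult\<close>)
  also have "\<dots> = norm s * norm (1 - s) * (\<Sum>n. real (n + Suc X) powr (- Re s - 1))"
    using s X powr_tail_sums(1)[of X "Re s"] by (intro suminf_mult) auto
  also have "\<dots> \<le> norm s * norm (1 - s) * (real X powr (- Re s) / Re s)"
    using powr_tail_sums(2)[OF X s(1)] by (intro mult_left_mono) auto
  finally have tl: "norm tail \<le> norm s * norm (1 - s) * (real X powr (- Re s) / Re s)" .
  have "norm (zeta s - zeta_sum X s) \<le> (norm (of_nat (Suc X) powr (1 - s)) + norm tail) / norm (s - 1)"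
    unfolding eq norm_divide by (intro divide_right_mono norm_triangle_ineq) auto
  also have "\<dots> \<le> (real (Suc X) powr (1 - Re s) + norm s * norm (1 - s) * (real X powr (- Re s) / Re s)) / norm (s - 1)"
    by (intro divide_right_mono add_mono tl) (simp_all add: norm_powr_real_powr del: of_nat_Suc)
  also have "\<dots> = real (Suc X) powr (1 - Re s) / norm (s - 1) + norm s * real X powr (- Re s) / Re s"
    using s by (simp add: add_divide_distrib norm_minus_commute)
  finally show ?thesis .
qed

text \<open>With the cut-off near \<open>T\<^sup>2\<close> the two errors are of order
  \<open>(T\<^sup>2) powr (1 / 4) / T\<close> and \<open>T * (T\<^sup>2) powr (- 3 / 4)\<close>,
  both \<open>T powr (- 1 / 2)\<close>. The region is wide enough to contain discs of radius
  \<open>1 / 8\<close> around the points treated in \<open>deriv_zeta_approx\<close>.\<close>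

lemma zeta_approx:
  fixes T :: real
  assumes T: "T \<ge> 4" and X: "real X \<ge> T\<^sup>2" "real (Suc X) \<le> 16 * T\<^sup>2"
    and s: "3 / 4 \<le> Re s" "Re s \<le> 2" "T / 4 \<le> Im s" "Im s \<le> 2 * T"
  shows "norm (zeta s - zeta_sum X s) \<le> 12 * T powr (- 1 / 2)"
proof -
  have X1: "X \<ge> 1" using X T
    by (metis One_nat_def Suc_leI less_numeral_extra(3) not_gr_zero of_nat_0 order.strict_trans1 power2_less_eq_zero_iff zero_less_numeral le_numeral_extra(3) not_numeral_le_zero)
  have s1: "s \<noteq> 1" using s T by auto
  have n1: "norm (s - 1) \<ge> T / 4" using abs_Im_le_cmod[of "s - 1"] s T by simp
  have n2: "norm s \<le> 3 * T" using cmod_le[of s] s T by linarith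
  have "real (Suc X) powr (1 - Re s) \<le> real (Suc X) powr (1 / 4)"
    using s by (intro powr_mono) auto
  also have "\<dots> \<le> (16 * T\<^sup>2) powr (1 / 4)" using X by (intro powr_mono2) auto
  also have "\<dots> = 16 powr (1/4) * T powr (1/2)"
    using T by (simp add: powr_mult powr_powr flip: powr_numeral)
  also have "(16::real) powr (1/4) = (2 powr 4) powr (1/4)" by simp
  also have "\<dots> = 2" by (simp only: powr_powr) simp
  finally have a: "real (Suc X) powr (1 - Re s) \<le> 2 * T powr (1/2)" .
  have "real (Suc X) powr (1 - Re s) / norm (s - 1) \<le> 2 * T powr (1/2) / (T / 4)"
    using a n1 T by (intro frac_le) auto
  also have "\<dots> = 8 * T powr (1/2 - 1)" using T by (simp only: powr_diff) simp
  finally have A: "real (Suc X) powr (1 - Re s) / norm (s - 1) \<le> 8 * T powr (- 1/2)" by simp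
  have "real X powr (- Re s) \<le> real X powr (- 3/4)" using s X1 by (intro powr_mono) auto
  also have "\<dots> \<le> (T\<^sup>2) powr (- 3/4)" using X T by (intro powr_mono2') auto
  also have "\<dots> = T powr (- 3/2)" using T by (simp add: powr_powr flip: powr_numeral)
  finally have b: "real X powr (- Re s) \<le> T powr (- 3/2)" .
  have "norm s * real X powr (- Re s) / Re s \<le> 3 * T * T powr (- 3/2) / (3/4)"
    using b n2 s T by (intro frac_le mult_mono) auto
  also have "\<dots> = 4 * T powr (1 + - 3/2)" using T by (simp only: powr_add) simp
  finally have B: "norm s * real X powr (- Re s) / Re s \<le> 4 * T powr (- 1/2)" by simp
  show ?thesis using norm_zeta_minus_sum_le[OF X1 _ s1] s A B by simp
qed

lemma zeta_sum_deriv: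
  "(zeta_sum X has_field_derivative (- (\<Sum>n\<in>{1..X}. of_real (ln n) * of_nat n powr (- s)))) (at s)"
  unfolding zeta_sum_def[abs_def]
  unfolding sum_negf[symmetric]
proof (rule DERIV_sum)
  fix n assume "n \<in> {1..X}"
  then have n: "n > 0" by auto
  show "((\<lambda>s. of_nat n powr (- s)) has_field_derivative (- (of_real (ln n) * of_nat n powr (- s)))) (at s)"
    using n unfolding powr_def by (auto intro!: derivative_eq_intros simp: Ln_of_nat)
qed

text \<open>Cauchy's inequality on a circle of radius \<open>1 / 8\<close> carries
  \<open>zeta_approx\<close> over to derivatives, with constant \<open>12 * 8\<close>.\<close>

lemma deriv_zeta_approx:
  fixes T :: real
  assumes T: "T \<ge> 4" and X: "real X \<ge> T\<^sup>2" "real (Suc X) \<le> 16 * T\<^sup>2"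
    and s: "7 / 8 \<le> Re s" "Re s \<le> 1" "T / 2 \<le> Im s" "Im s \<le> T"
  shows "norm (deriv zeta s - deriv (zeta_sum X) s) \<le> 96 * T powr (- 1 / 2)"
proof -
  let ?f = "\<lambda>s. zeta s - zeta_sum X s"
  have "s \<noteq> 1" using s T by auto
  have near: "3 / 4 \<le> Re z \<and> Re z \<le> 2 \<and> T / 4 \<le> Im z \<and> Im z \<le> 2 * T" if "norm (s - z) \<le> 1 / 8" for z
    using that abs_Re_le_cmod[of "s - z"] abs_Im_le_cmod[of "s - z"] s T by (auto simp: abs_le_iff)
  have hol: "?f holomorphic_on cball s (1/8)"
  proof (intro holomorphic_intros holomorphic_on_subset[OF zeta_holomorphic])
    show "cball s (1/8) \<subseteq> - {1}" using near[of 1] T by (auto simp: dist_norm)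
    show "zeta_sum X holomorphic_on cball s (1/8)"
      by (meson zeta_sum_deriv holomorphic_on_open holomorphic_on_subset open_UNIV subset_UNIV)
  qed
  have "norm ((deriv ^^ 1) ?f s) \<le> fact 1 * (12 * T powr (- 1 / 2)) / (1 / 8) ^ 1"
  proof (rule Cauchy_inequality)
    show "?f holomorphic_on ball s (1/8)" using hol by (rule holomorphic_on_subset) auto
    show "continuous_on (cball s (1/8)) ?f" using hol by (rule holomorphic_on_imp_continuous_on)
    show "norm (?f x) \<le> 12 * T powr (- 1/2)" if "norm (s - x) = 1/8" for x
      using near[of x] that by (intro zeta_approx[OF T X]) auto
  qed auto
  moreover have "deriv ?f s = deriv zeta s - deriv (zeta_sum X) s"
  proof (rule deriv_diff)
    show "zeta field_differentiable at s"
      using zeta_holomorphic \<open>s \<noteq> 1\<close> by (auto intro: holomorphic_on_imp_differentiable_at[of _ "- {1}"])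
    show "zeta_sum X field_differentiable at s"
      using zeta_sum_deriv field_differentiable_def by blast
  qed
  ultimately show ?thesis by simp
qed

section \<open>Mean values of Dirichlet polynomials\<close>

lemma cos_integral:
  fixes l U V :: real
  assumes UV: "U \<le> V" and l: "l \<noteq> 0"
  shows "\<bar>integral {U..V} (\<lambda>t. cos (l * t))\<bar> \<le> 2 / \<bar>l\<bar>"
proof -
  have "((\<lambda>t. cos (l * t)) has_integral (sin (l * V) / l - sin (l * U) / l)) {U..V}"
    using UV l by (intro fundamental_theorem_of_calculus)
      (auto intro!: derivative_eq_intros simp flip: has_real_derivative_iff_has_vector_derivative)
  then have *: "integral {U..V} (\<lambda>t. cos (l * t)) = (sin (l * V) - sin (l * U)) / l"
    by (simp add: integral_unique diff_divide_distrib)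
  have "\<bar>sin (l * V) - sin (l * U)\<bar> \<le> 2"
    using abs_sin_le_one[of "l * V"] abs_sin_le_one[of "l * U"] by linarith
  then show ?thesis
    unfolding * abs_divide by (intro divide_right_mono) auto
qed

definition dpoly :: "nat \<Rightarrow> (nat \<Rightarrow> real) \<Rightarrow> complex \<Rightarrow> complex" where
  "dpoly Z a s = (\<Sum>n\<in>{1..Z}. of_real (a n) * of_nat n powr (- s))"

lemma powr_minus_Complex:
  assumes "n \<ge> 1"
  shows "of_nat n powr (- Complex \<sigma> t) = of_real (real n powr (- \<sigma>)) * cis (- (t * ln n))"
proof -
  have "exp (- (Complex \<sigma> t * of_real (ln (real n)))) = exp (of_real (- \<sigma> * ln n)) * exp (\<i> * of_real (- (t * ln n)))"
    unfolding exp_add[symmetric] by (intro arg_cong[of _ _ exp]) (simp add: complex_eq_iff)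
  then show ?thesis using assms
    by (simp add: powr_def Ln_of_nat cis_conv_exp flip: exp_of_real)
qed

lemma Re_dpoly_cnj:
  "Re (dpoly Z b (Complex \<sigma> t) * cnj (dpoly Z a (Complex \<sigma> t))) =
     (\<Sum>m\<in>{1..Z}. \<Sum>n\<in>{1..Z}. b m * a n * (real m * real n) powr (- \<sigma>) * cos ((ln n - ln m) * t))"
proof -
  have "dpoly Z b (Complex \<sigma> t) * cnj (dpoly Z a (Complex \<sigma> t)) =
     (\<Sum>m\<in>{1..Z}. \<Sum>n\<in>{1..Z}. of_real (b m * a n * (real m * real n) powr (- \<sigma>)) * cis ((ln n - ln m) * t))"
    unfolding dpoly_def cnj_sum sum_product
  proof (intro sum.cong refl)
    fix m n assume "m \<in> {1..Z}" "n \<in> {1..Z}"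
    then have mn: "m \<ge> 1" "n \<ge> 1" by auto
    have "cis (- (t * ln m)) * cis (t * ln n) = cis ((ln n - ln m) * t)"
      by (simp add: cis_mult algebra_simps)
    then show "of_real (b m) * of_nat m powr (- Complex \<sigma> t) * cnj (of_real (a n) * of_nat n powr (- Complex \<sigma> t)) =
        of_real (b m * a n * (real m * real n) powr (- \<sigma>)) * cis ((ln n - ln m) * t)"
      unfolding powr_minus_Complex[OF mn(1)] powr_minus_Complex[OF mn(2)]
      by (simp add: powr_mult mult_ac cis_cnj)
  qed
  then show ?thesis by simp
qed

text \<open>Partial fractions: \<open>1 / (m * (n - m)) = (1 / m + 1 / (n - m)) / n\<close>.\<close>

lemma sum_inverse_products:
  assumes "n \<ge> 1"
  shows "(\<Sum>m\<in>{1..<n}. 1 / (real m * real (n - m))) \<le> 2 * harm n / n"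
proof -
  have "(\<Sum>m\<in>{1..<n}. 1 / (real m * real (n - m))) = (\<Sum>m\<in>{1..<n}. (1 / m + 1 / real (n - m)) / n)"
    by (intro sum.cong) (auto simp: field_simps of_nat_diff)
  also have "\<dots> = ((\<Sum>m\<in>{1..<n}. 1 / real m) + (\<Sum>m\<in>{1..<n}. 1 / real (n - m))) / n"
    by (simp add: sum.distrib sum_divide_distrib[symmetric])
  also have "(\<Sum>m\<in>{1..<n}. 1 / real (n - m)) = (\<Sum>m\<in>{1..<n}. 1 / real m)"
    by (rule sum.reindex_bij_witness[of _ "\<lambda>m. n - m" "\<lambda>m. n - m"]) auto
  also have "(\<Sum>m\<in>{1..<n}. 1 / real m) \<le> harm n"
    unfolding harm_def by (intro order_trans[OF _ sum_mono2[of "{1..n}" "{1..<n}"]]) (auto simp: inverse_eq_divide)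
  finally show ?thesis by (simp add: divide_right_mono)
qed

text \<open>The inequality \<open>ln n - ln m \<ge> (n - m) / n\<close> reduces the inner sum to
  \<open>sum_inverse_products\<close>; what remains is \<open>(m * n) powr (1 - \<sigma>)\<close>,
  at most \<open>Z powr (2 - 2 * \<sigma>)\<close>.\<close>

lemma offdiag_sum_le:
  fixes \<sigma> :: real
  assumes s: "\<sigma> \<le> 1"
  shows "(\<Sum>n\<in>{1..Z}. \<Sum>m\<in>{1..<n}. (real m * real n) powr (- \<sigma>) / (ln n - ln m))
     \<le> 2 * harm Z * (harm Z * real Z powr (2 - 2 * \<sigma>))"
proof -
  have "(\<Sum>m\<in>{1..<n}. (real m * real n) powr (- \<sigma>) / (ln n - ln m)) \<le> 2 * harm Z * (inverse (real n) * real Z powr (2 - 2 * \<sigma>))"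
    if n: "n \<in> {1..Z}" for n
  proof -
    have "(\<Sum>m\<in>{1..<n}. (real m * real n) powr (- \<sigma>) / (ln n - ln m)) \<le>
       (\<Sum>m\<in>{1..<n}. real n powr (2 - 2 * \<sigma>) * (1 / (real m * real (n - m))))"
    proof (rule sum_mono)
      fix m assume m: "m \<in> {1..<n}"
      have "ln (real m / real n) \<le> real m / real n - 1" using m by (intro ln_le_minus_one) auto
      then have l: "ln n - ln m \<ge> real (n - m) / n"
        using m by (simp add: ln_div of_nat_diff diff_divide_distrib)
      have w: "(real m * real n) powr (- \<sigma>) = real m powr (1 - \<sigma>) * real n powr (1 - \<sigma>) / (real m * real n)"
        using m by (simp add: powr_mult powr_diff powr_minus field_simps)
      have "(real m * real n) powr (- \<sigma>) / (ln n - ln m) \<le> (real m * real n) powr (- \<sigma>) / (real (n - m) / n)"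
        using l m by (intro divide_left_mono) auto
      also have "\<dots> = real m powr (1 - \<sigma>) * real n powr (1 - \<sigma>) * (1 / (real m * real (n - m)))"
        unfolding w using m by (simp add: field_simps)
      also have "\<dots> \<le> real n powr (1 - \<sigma>) * real n powr (1 - \<sigma>) * (1 / (real m * real (n - m)))"
        using m s by (intro mult_right_mono powr_mono2) auto
      also have "real n powr (1 - \<sigma>) * real n powr (1 - \<sigma>) = real n powr (2 - 2 * \<sigma>)"
        by (simp flip: powr_add)
      finally show "(real m * real n) powr (- \<sigma>) / (ln n - ln m) \<le> real n powr (2 - 2 * \<sigma>) * (1 / (real m * real (n - m)))" .
    qed
    also have "\<dots> \<le> real Z powr (2 - 2 * \<sigma>) * (2 * harm n / n)"
      unfolding sum_distrib_left[symmetric] using n s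
      by (intro mult_mono powr_mono2 sum_inverse_products) (auto intro!: sum_nonneg)
    also have "\<dots> \<le> real Z powr (2 - 2 * \<sigma>) * (2 * harm Z / n)"
      using n by (intro mult_left_mono divide_right_mono harm_mono) auto
    finally show ?thesis by (simp add: field_simps)
  qed
  then have "(\<Sum>n\<in>{1..Z}. \<Sum>m\<in>{1..<n}. (real m * real n) powr (- \<sigma>) / (ln n - ln m))
     \<le> (\<Sum>n\<in>{1..Z}. 2 * harm Z * (inverse (real n) * real Z powr (2 - 2 * \<sigma>)))" by (rule sum_mono)
  also have "\<dots> = 2 * harm Z * (harm Z * real Z powr (2 - 2 * \<sigma>))"
    by (simp add: harm_def sum_distrib_left sum_distrib_right mult_ac)
  finally show ?thesis .
qed

lemma continuous_on_dpoly: "continuous_on A (\<lambda>t. dpoly Z a (Complex \<sigma> t))"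
proof -
  have "(\<lambda>t. dpoly Z a (Complex \<sigma> t)) = (\<lambda>t. \<Sum>n\<in>{1..Z}. of_real (a n) * (of_real (real n powr (- \<sigma>)) * cis (- (t * ln n))))"
    unfolding dpoly_def by (intro ext sum.cong) (auto simp: powr_minus_Complex)
  then show ?thesis by (simp only:) (intro continuous_intros)
qed

text \<open>On the diagonal the integrand is constant; off it \<open>cos_integral\<close> applies.
  Using only maxima of the coefficients is crude, but in the application these are at most a small
  power of \<open>T\<close> times a logarithm and \<open>\<sigma>\<close> is close to 1, so the
  error stays far below the length of the interval.\<close>

lemma mean_value_dpoly:
  fixes \<sigma> U V Ka Kb :: real
  assumes s: "\<sigma> \<le> 1" and UV: "U \<le> V" and a: "\<And>n. n \<in> {1..Z} \<Longrightarrow> \<bar>a n\<bar> \<le> Ka" and b: "\<And>n. n \<in> {1..Z} \<Longrightarrow> \<bar>b n\<bar> \<le> Kb" and K: "Ka \<ge> 0" "Kb \<ge> 0"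
  shows "\<bar>integral {U..V} (\<lambda>t. Re (dpoly Z b (Complex \<sigma> t) * cnj (dpoly Z a (Complex \<sigma> t))))
     - (V - U) * (\<Sum>n\<in>{1..Z}. b n * a n * real n powr (- 2 * \<sigma>))\<bar> \<le> 8 * Kb * Ka * (harm Z)\<^sup>2 * real Z powr (2 - 2 * \<sigma>)"
proof -
  define w where "w m n = (real m * real n) powr (- \<sigma>)" for m n :: nat
  define J where "J m n = integral {U..V} (\<lambda>t. cos ((ln (real n) - ln (real m)) * t))" for m n :: nat
  let ?I = "{1..Z}"
  have int: "integral {U..V} (\<lambda>t. Re (dpoly Z b (Complex \<sigma> t) * cnj (dpoly Z a (Complex \<sigma> t)))) =
     (\<Sum>m\<in>?I. \<Sum>n\<in>?I. b m * a n * w m n * J m n)"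
    unfolding Re_dpoly_cnj w_def J_def
    by (subst integral_sum, (auto intro!: integrable_continuous_interval continuous_intros)[2],
        intro sum.cong refl, subst integral_sum)
       (auto intro!: integrable_continuous_interval continuous_intros)
  have inner: "(\<Sum>n\<in>?I. b m * a n * w m n * J m n) = b m * a m * w m m * J m m + (\<Sum>n\<in>?I - {m}. b m * a n * w m n * J m n)"
    if "m \<in> ?I" for m using that by (subst sum.remove[of _ m]) auto
  have diag: "w m m * J m m = (V - U) * real m powr (- 2 * \<sigma>)" for m
    using UV by (simp add: w_def J_def powr_mult flip: powr_add)
  have "integral {U..V} (\<lambda>t. Re (dpoly Z b (Complex \<sigma> t) * cnj (dpoly Z a (Complex \<sigma> t)))) - (V - U) * (\<Sum>n\<in>?I. b n * a n * real n powr (- 2 * \<sigma>))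
    = (\<Sum>m\<in>?I. \<Sum>n\<in>?I - {m}. b m * a n * w m n * J m n)"
    unfolding int using inner diag by (simp add: sum.distrib sum_distrib_left mult.assoc mult_ac)
  also have "\<bar>\<dots>\<bar> \<le> (\<Sum>m\<in>?I. \<Sum>n\<in>?I - {m}. \<bar>b m * a n * w m n * J m n\<bar>)"
    by (intro order_trans[OF sum_abs] sum_mono sum_abs)
  also have "\<dots> \<le> (\<Sum>m\<in>?I. \<Sum>n\<in>?I - {m}. Kb * Ka * (w m n * (2 / \<bar>ln n - ln m\<bar>)))"
  proof (intro sum_mono)
    fix m n assume m: "m \<in> ?I" and n: "n \<in> ?I - {m}"
    then have "ln (real n) - ln (real m) \<noteq> 0" by auto
    from cos_integral[OF UV this] have J: "\<bar>J m n\<bar> \<le> 2 / \<bar>ln n - ln m\<bar>" by (simp add: J_def)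
    have "w m n \<ge> 0" by (simp add: w_def)
    have "\<bar>b m * a n * w m n * J m n\<bar> = (\<bar>b m\<bar> * \<bar>a n\<bar>) * (w m n * \<bar>J m n\<bar>)"
      using \<open>w m n \<ge> 0\<close> by (simp add: abs_mult)
    also have "\<dots> \<le> (Kb * Ka) * (w m n * (2 / \<bar>ln n - ln m\<bar>))"
      using \<open>w m n \<ge> 0\<close> K a[of n] n b[OF m] J by (intro mult_mono) auto
    finally show "\<bar>b m * a n * w m n * J m n\<bar> \<le> Kb * Ka * (w m n * (2 / \<bar>ln n - ln m\<bar>))" .
  qed
  also have "\<dots> = 2 * Kb * Ka * (\<Sum>m\<in>?I. \<Sum>n\<in>?I - {m}. w m n / \<bar>ln n - ln m\<bar>)"
    by (simp add: sum_distrib_left mult_ac)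
  \<comment> \<open>The triangles \<open>n < m\<close> and \<open>n > m\<close> contribute equally
    because \<open>w\<close> is symmetric; this turns the factor 2 into 4.\<close>
  also have "(\<Sum>m\<in>?I. \<Sum>n\<in>?I - {m}. w m n / \<bar>ln n - ln m\<bar>) = (\<Sum>m\<in>?I. (\<Sum>n\<in>{1..<m}. w m n / \<bar>ln n - ln m\<bar>) + (\<Sum>n\<in>{m<..Z}. w m n / \<bar>ln n - ln m\<bar>))"
  proof (intro sum.cong refl)
    fix m assume "m \<in> ?I"
    then have eq: "?I - {m} = {1..<m} \<union> {m<..Z}" by auto
    show "(\<Sum>n\<in>?I - {m}. w m n / \<bar>ln n - ln m\<bar>) = (\<Sum>n\<in>{1..<m}. w m n / \<bar>ln n - ln m\<bar>) + (\<Sum>n\<in>{m<..Z}. w m n / \<bar>ln n - ln m\<bar>)"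
      unfolding eq by (rule sum.union_disjoint) auto
  qed
  also have "\<dots> = (\<Sum>m\<in>?I. \<Sum>n\<in>{1..<m}. w m n / \<bar>ln n - ln m\<bar>) + (\<Sum>m\<in>?I. \<Sum>n\<in>{m<..Z}. w m n / \<bar>ln n - ln m\<bar>)"
    by (rule sum.distrib)
  also have "(\<Sum>m\<in>?I. \<Sum>n\<in>{m<..Z}. w m n / \<bar>ln n - ln m\<bar>) = (\<Sum>m\<in>?I. \<Sum>n | n \<in> ?I \<and> m < n. w m n / \<bar>ln n - ln m\<bar>)"
    by (intro sum.cong) auto
  also have "\<dots> = (\<Sum>n\<in>?I. \<Sum>m | m \<in> ?I \<and> m < n. w m n / \<bar>ln n - ln m\<bar>)"
    by (intro sum.swap_restrict) auto
  also have "\<dots> = (\<Sum>n\<in>?I. \<Sum>m\<in>{1..<n}. w n m / \<bar>ln m - ln n\<bar>)"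
    by (intro sum.cong) (auto simp: w_def mult_ac abs_minus_commute)
  also have "(\<Sum>n\<in>?I. \<Sum>m\<in>{1..<n}. w n m / \<bar>ln m - ln n\<bar>) = (\<Sum>n\<in>?I. \<Sum>m\<in>{1..<n}. (real m * real n) powr (- \<sigma>) / (ln n - ln m))"
    by (intro sum.cong refl) (auto simp: w_def mult.commute)
  finally have "\<bar>integral {U..V} (\<lambda>t. Re (dpoly Z b (Complex \<sigma> t) * cnj (dpoly Z a (Complex \<sigma> t)))) - (V - U) * (\<Sum>n\<in>?I. b n * a n * real n powr (- 2 * \<sigma>))\<bar>
    \<le> 4 * Kb * Ka * (\<Sum>n\<in>?I. \<Sum>m\<in>{1..<n}. (real m * real n) powr (- \<sigma>) / (ln n - ln m))" by simp
  also have "\<dots> \<le> 4 * Kb * Ka * (2 * harm Z * (harm Z * real Z powr (2 - 2 * \<sigma>)))"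
    using K by (intro mult_left_mono offdiag_sum_le s) auto
  finally show ?thesis by (simp add: power2_eq_square mult_ac)
qed

section \<open>Mertens' theorem\<close>

definition theta :: "nat \<Rightarrow> real" where "theta n = (\<Sum>p | prime p \<and> p \<le> n. ln (real p))"
definition mertens :: "nat \<Rightarrow> real" where "mertens n = (\<Sum>p | prime p \<and> p \<le> n. ln (real p) / real p)"

lemma finite_primes_le [simp]: "finite {p :: nat. prime p \<and> p \<le> n}" "finite {p :: nat. prime p \<and> m < p \<and> p \<le> n}"
  by (auto intro: finite_subset[of _ "{..n}"])

lemma no_primes_le_1: "{p :: nat. prime p \<and> p \<le> Suc 0} = {}"
  by (auto dest: prime_ge_2_nat)

lemma ln_prod_primes:
  assumes "finite P" "\<And>p. p \<in> P \<Longrightarrow> prime (p :: nat)"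
  shows "(\<Sum>p\<in>P. ln (real p)) = ln (\<Prod>P)"
  using assms by (simp add: of_nat_prod ln_prod prime_gt_0_nat)

lemma prod_primes_dvd:
  assumes "finite P" "\<And>p. p \<in> P \<Longrightarrow> prime (p :: nat)" "\<And>p. p \<in> P \<Longrightarrow> p dvd n"
  shows "\<Prod>P dvd n"
  using assms
proof (induction P)
  case (insert p P)
  have "coprime p (\<Prod>P)"
    by (rule prod_coprime_right) (use insert in \<open>auto intro: primes_coprime\<close>)
  then show ?case using insert by (simp add: divides_mult)
qed auto

text \<open>All primes in \<open>{n<..2 * n}\<close> divide the central binomial coefficient, hence
  so does their product, and that coefficient is at most \<open>2 ^ (2 * n)\<close>.\<close>

lemma theta_double_le: "theta (2 * n) \<le> theta n + 2 * n * ln 2"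
proof -
  define P where "P = {p. prime p \<and> n < p \<and> p \<le> 2 * n}"
  have "p dvd (2 * n) choose n" if "p \<in> P" for p
  proof -
    have p: "prime p" "n < p" "p \<le> 2 * n" using that by (auto simp: P_def)
    have "fact (2 * n) = fact n * fact n * ((2 * n) choose n)"
      using binomial_fact_lemma[of n "2 * n"] by (simp add: mult_2)
    moreover have "p dvd fact (2 * n)" using p by (simp add: prime_dvd_fact_iff)
    moreover have "\<not> p dvd fact n" using p by (simp add: prime_dvd_fact_iff)
    ultimately show ?thesis using p by (metis prime_dvd_mult_iff)
  qed
  then have "\<Prod>P dvd (2 * n) choose n" by (intro prod_primes_dvd) (auto simp: P_def)
  then have "\<Prod>P \<le> (2 * n) choose n" by (rule dvd_imp_le) simp
  also have "\<dots> \<le> 2 ^ (2 * n)" by (rule binomial_le_pow2)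
  finally have "real (\<Prod>P) \<le> 2 ^ (2 * n)" by (metis of_nat_le_iff of_nat_numeral of_nat_power)
  moreover have "real (\<Prod>P) > 0" unfolding of_nat_0_less_iff by (intro prod_pos) (auto simp: P_def prime_gt_0_nat)
  ultimately have "ln (real (\<Prod>P)) \<le> ln (2 ^ (2 * n))" by (subst ln_le_cancel_iff) (simp_all only: zero_less_power zero_less_numeral)
  then have "(\<Sum>p\<in>P. ln (real p)) \<le> 2 * n * ln 2"
    by (subst ln_prod_primes) (auto simp: P_def ln_realpow)
  moreover have "{p. prime p \<and> p \<le> 2 * n} = {p. prime p \<and> p \<le> n} \<union> P" by (auto simp: P_def)
  then have "theta (2 * n) = theta n + (\<Sum>p\<in>P. ln (real p))"
    unfolding theta_def by (simp only:) (subst sum.union_disjoint, auto simp: P_def)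
  ultimately show ?thesis by simp
qed

lemma theta_mono: "m \<le> n \<Longrightarrow> theta m \<le> theta n"
  unfolding theta_def by (intro sum_mono2) (auto simp: prime_ge_1_nat)

text \<open>Induction by halving: with \<open>m = (n + 1) div 2\<close> the bound obtained is
  \<open>8 * m \<le> 4 * (n + 1)\<close>, which is at most \<open>6 * n\<close> for
  \<open>n \<ge> 2\<close>.\<close>

lemma theta_le: "theta n \<le> 6 * n"
proof (induction n rule: less_induct)
  case (less n)
  show ?case
  proof (cases "n \<le> 1")
    case True
    then have "theta n \<le> theta (Suc 0)" by (intro theta_mono) simp
    also have "\<dots> = 0" unfolding theta_def no_primes_le_1 by simp
    finally show ?thesis by (rule order_trans) simp
  next
    case False
    define m where "m = (n + 1) div 2"
    have m: "m < n" "n \<le> 2 * m" "2 * m \<le> n + 1" using False by (auto simp: m_def)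
    have "theta n \<le> theta (2 * m)" using m by (intro theta_mono)
    also have "\<dots> \<le> theta m + 2 * m * ln 2" using theta_double_le[of m] by simp
    also have "\<dots> \<le> 6 * real m + 2 * real m * 1"
      using less.IH[OF m(1)] ln_2_less_1 mult_left_mono[of "ln 2" 1 "2 * real m"] by simp
    also have "\<dots> \<le> 6 * real n" using m False by linarith
    finally show ?thesis by simp
  qed
qed

section \<open>Factorials and the exponents of primes in them\<close>

lemma ln_fact_ge: "ln (fact n) \<ge> n * ln n - n"
proof (cases "n = 0")
  case False
  \<comment> \<open>A single term of the exponential series is at most its sum.\<close>
  have "real n ^ n / fact n \<le> exp (real n)"
  proof -
    have "(\<lambda>k. real n ^ k / fact k) sums exp (real n)"
      using exp_converges[of "real n"] by (simp add: field_simps)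
    then have "(\<Sum>k\<in>{n}. real n ^ k / fact k) \<le> exp (real n)"
      unfolding sums_iff by (metis (no_types, lifting) sum_le_suminf finite.emptyI finite.insertI divide_nonneg_pos zero_le_power of_nat_0_le_iff fact_gt_zero)
    then show ?thesis by simp
  qed
  then have "real n ^ n \<le> exp (real n) * fact n" by (simp add: field_simps)
  then have "ln (real n ^ n) \<le> ln (exp (real n) * fact n)" using False by (subst ln_le_cancel_iff) auto
  then show ?thesis using False by (simp add: ln_mult ln_realpow)
qed auto

lemma ln_fact_le: "ln (fact n) \<le> n * ln n"
proof (cases "n = 0")
  case False
  have "fact n \<le> real (n ^ n)" using fact_le_power[of n] by (metis le_refl of_nat_fact of_nat_mono)
  then have "ln (fact n) \<le> ln (real n ^ n)" by (subst ln_le_cancel_iff) (use False in auto)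
  then show ?thesis using False by (simp add: ln_realpow)
qed auto

lemma ln_eq_sum_multiplicity:
  assumes "n > 0"
  shows "ln (real n) = (\<Sum>p\<in>prime_factors n. real (multiplicity p n) * ln (real p))"
proof -
  have "real n = (\<Prod>p\<in>prime_factors n. real p ^ multiplicity p n)"
    using prime_factorization_nat[OF assms] by (metis (no_types, lifting) of_nat_power of_nat_prod prod.cong)
  then have "ln (real n) = ln (\<Prod>p\<in>prime_factors n. real p ^ multiplicity p n)" by simp
  also have "\<dots> = (\<Sum>p\<in>prime_factors n. ln (real p ^ multiplicity p n))"
    by (intro ln_prod) (auto simp: in_prime_factors_iff prime_gt_0_nat)
  also have "\<dots> = (\<Sum>p\<in>prime_factors n. real (multiplicity p n) * ln (real p))"
    by (intro sum.cong refl ln_realpow)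
  finally show ?thesis .
qed

text \<open>The multiples \<open>p, 2 * p, \<dots>, k * p\<close> among the factors of
  \<open>fact (p * k)\<close> have product \<open>p ^ k * fact k\<close>.\<close>

lemma div_le_multiplicity_fact:
  assumes "prime p"
  shows "n div p \<le> multiplicity p (fact n :: nat)"
proof -
  have "p ^ k * fact k dvd (fact (p * k) :: nat)" for k
  proof (induction k)
    case (Suc k)
    have "p * Suc k * fact (p * k) dvd (fact (p * Suc k) :: nat)"
    proof -
      obtain q where q: "p = Suc q" using assms prime_gt_0_nat gr0_implies_Suc by blast
      have "p * Suc k = Suc (q + p * k)" using q by simp
      then have "(fact (p * Suc k) :: nat) = (p * Suc k) * fact (q + p * k)" by (metis fact_Suc of_nat_id)
      moreover have "fact (p * k) dvd (fact (q + p * k) :: nat)" by (intro fact_dvd) simp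
      ultimately show ?thesis by (metis mult_dvd_mono dvd_refl)
    qed
    moreover have "p ^ Suc k * fact (Suc k) dvd p * Suc k * fact (p * k)"
      using mult_dvd_mono[OF dvd_refl Suc.IH, of "p * Suc k"]
      by (simp only: fact_Suc power_Suc of_nat_id mult_ac)
    ultimately show ?case by (rule dvd_trans[rotated])
  qed auto
  from this[of "n div p"] have "p ^ (n div p) dvd (fact (p * (n div p)) :: nat)" by (rule dvd_mult_left)
  also have "\<dots> dvd fact n" by (intro fact_dvd) simp
  finally show ?thesis using assms by (intro multiplicity_geI) auto
qed

text \<open>Legendre's formula in recursive form: for \<open>r < p\<close> the exponent of
  \<open>p\<close> in \<open>fact (p * k + r)\<close> is \<open>k\<close> plus that in
  \<open>fact k\<close>. By induction, the exponent times \<open>p - 1\<close> is then at most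
  \<open>k * (p - 1) + k = p * k \<le> n\<close>.\<close>

lemma multiplicity_fact_le:
  assumes p: "prime p"
  shows "real (multiplicity p (fact n :: nat)) * (real p - 1) \<le> n"
proof (induction n rule: less_induct)
  case (less n)
  show ?case
  proof (cases "n < p")
    case True
    then have "\<not> p dvd fact n" using p by (simp add: prime_dvd_fact_iff)
    then show ?thesis by (simp add: not_dvd_imp_multiplicity_0)
  next
    case False
    \<comment> \<open>Induction on \<open>p * k + r\<close>: for \<open>r > 0\<close> the last
      factor is prime to \<open>p\<close>; for \<open>r = 0\<close> it is \<open>p * k\<close>, and
      the preceding number is \<open>p * (k - 1) + (p - 1)\<close>.\<close>
    have *: "multiplicity p (fact (p * k + r) :: nat) = k + multiplicity p (fact k :: nat)" if "r < p" for k r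
      using that
    proof (induction "p * k + r" arbitrary: k r)
      case 0
      then show ?case using p by (auto simp: prime_gt_0_nat)
    next
      case (Suc m)
      show ?case
      proof (cases r)
        case (Suc r')
        have "\<not> p dvd p * k + r" using \<open>r < p\<close> Suc
          by (simp only: dvd_add_right_iff dvd_triv_left) (auto dest: dvd_imp_le)
        then have "multiplicity p (p * k + r) = 0" by (rule not_dvd_imp_multiplicity_0)
        moreover have "(fact (p * k + r) :: nat) = (p * k + r) * fact (p * k + r')" using Suc by simp
        moreover have "multiplicity p (fact (p * k + r') :: nat) = k + multiplicity p (fact k :: nat)"
          using Suc.hyps(1)[of k r'] Suc.hyps(2) Suc.prems Suc by simp
        moreover have "multiplicity p ((p * k + r) * fact (p * k + r') :: nat) =
            multiplicity p (p * k + r) + multiplicity p (fact (p * k + r') :: nat)"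
          using p Suc by (intro prime_elem_multiplicity_mult_distrib) auto
        ultimately show ?thesis by simp
      next
        case 0
        then obtain k' where k': "k = Suc k'" using Suc.hyps(2) by (cases k) auto
        have m: "m = p * k' + (p - 1)" using Suc.hyps(2) 0 k' p prime_gt_0_nat[OF p] by simp
        have IH: "multiplicity p (fact m :: nat) = k' + multiplicity p (fact k' :: nat)"
          using Suc.hyps(1)[OF m] p prime_gt_0_nat[OF p] m by simp
        have "(fact (p * k + r) :: nat) = p * (k * fact m)"
          using Suc.hyps(2) 0 by (metis add_0_right fact_Suc of_nat_id mult.assoc)
        moreover have "multiplicity p (p * (k * fact m)) = 1 + multiplicity p (k * fact m)"
          using p k' by (simp only: prime_elem_multiplicity_mult_distrib) (simp add: prime_elem_multiplicity_mult_distrib)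
        moreover have "multiplicity p (k * fact m) = multiplicity p k + multiplicity p (fact m :: nat)"
          using p k' by (intro prime_elem_multiplicity_mult_distrib) auto
        ultimately have "multiplicity p (fact (p * k + r) :: nat) = 1 + (multiplicity p k + multiplicity p (fact m :: nat))"
          by simp
        also have "\<dots> = k + multiplicity p (fact k :: nat)"
        proof -
          have "multiplicity p (fact k :: nat) = multiplicity p (k * fact k')" using k' by simp
          also have "\<dots> = multiplicity p k + multiplicity p (fact k' :: nat)"
            using p k' by (intro prime_elem_multiplicity_mult_distrib) auto
          finally show ?thesis using IH k' by simp
        qed
        finally show ?thesis .
      qed
    qed
    define k where "k = n div p"
    have "n = p * k + n mod p" by (simp add: k_def)
    then have m: "multiplicity p (fact n :: nat) = k + multiplicity p (fact k :: nat)"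
      using *[of "n mod p" k] p prime_gt_0_nat[OF p] by simp
    have "k < n" using False p prime_gt_1_nat[OF p] by (simp add: k_def)
    from less.IH[OF this] have "real (multiplicity p (fact n :: nat)) * (real p - 1) \<le> real k * (real p - 1) + real k"
      unfolding m by (simp add: algebra_simps)
    also have "\<dots> = real (p * k)" by (simp add: algebra_simps)
    also have "\<dots> \<le> n" by (simp add: k_def del: of_nat_mult)
    finally show ?thesis .
  qed
qed

section \<open>Upper and lower estimates for \<open>mertens\<close>\<close>

lemma ln_fact_eq:
  "ln (fact n) = (\<Sum>p | prime p \<and> p \<le> n. real (multiplicity p (fact n :: nat)) * ln (real p))"
proof -
  have "prime_factors (fact n :: nat) = {p. prime p \<and> p \<le> n}"
    by (auto simp: prime_factors_dvd prime_dvd_fact_iff)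
  then show ?thesis using ln_eq_sum_multiplicity[of "fact n"] by simp
qed

text \<open>In \<open>ln (fact n)\<close> each \<open>ln p\<close> occurs at least
  \<open>n div p\<close> times. Rounding \<open>n / p\<close> down loses less than 1 per prime, in
  total at most \<open>theta n\<close>, which is \<open>O(n)\<close> by Chebyshev's bound.\<close>

lemma mertens_le:
  assumes n: "n \<ge> 1"
  shows "mertens n \<le> ln n + 6"
proof -
  have "real n * mertens n = (\<Sum>p | prime p \<and> p \<le> n. real n / real p * ln (real p))"
    by (simp add: mertens_def sum_distrib_left)
  also have "\<dots> \<le> (\<Sum>p | prime p \<and> p \<le> n. (real (multiplicity p (fact n :: nat)) + 1) * ln (real p))"
  proof (intro sum_mono mult_right_mono)
    fix p assume "p \<in> {p. prime p \<and> p \<le> n}"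
    then have p: "prime p" by simp
    have "real n / real p \<le> real (n div p) + 1" 
    proof -
      have "real n = real p * real (n div p) + real (n mod p)" by (simp flip: of_nat_mult of_nat_add)
      moreover have "real (n mod p) \<le> real p" using prime_gt_0_nat[OF p] by (simp add: less_imp_le)
      ultimately show ?thesis using prime_gt_0_nat[OF p] by (simp add: field_simps)
    qed
    then show "real n / real p \<le> real (multiplicity p (fact n :: nat)) + 1"
      using div_le_multiplicity_fact[OF p, of n] by linarith
    show "0 \<le> ln (real p)" using p prime_ge_1_nat[OF p] by simp
  qed
  also have "\<dots> = ln (fact n) + theta n"
    by (simp add: ln_fact_eq theta_def distrib_right sum.distrib)
  also have "\<dots> \<le> n * ln n + 6 * n" by (intro add_mono ln_fact_le theta_le)
  also have "\<dots> = real n * (ln n + 6)" by (simp add: algebra_simps)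
  finally show ?thesis using n by simp
qed

text \<open>This controls higher powers of primes in factorials, through
  \<open>1 / (p - 1) = 1 / p + 1 / (p * (p - 1))\<close>. The bounds
  \<open>ln p \<le> 2 * p powr (1 / 2)\<close> and \<open>p - 1 \<ge> p / 2\<close> give a
  convergent majorant.\<close>

lemma sum_ln_div_square_le:
  "\<exists>C\<ge>0. \<forall>n. (\<Sum>p | prime p \<and> p \<le> n. ln (real p) / (real p * (real p - 1))) \<le> C"
proof -
  have sm: "summable (\<lambda>n. 4 * real n powr (- 3 / 2))" by (intro summable_mult) (simp add: summable_real_powr_iff)
  define C where "C = (\<Sum>n. 4 * real n powr (- 3 / 2))"
  have "(\<Sum>p | prime p \<and> p \<le> n. ln (real p) / (real p * (real p - 1))) \<le> C" for n
  proof -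
    have "(\<Sum>p | prime p \<and> p \<le> n. ln (real p) / (real p * (real p - 1))) \<le> (\<Sum>p | prime p \<and> p \<le> n. 4 * real p powr (- 3 / 2))"
    proof (intro sum_mono)
      fix p assume "p \<in> {p. prime p \<and> p \<le> n}"
      then have p: "real p \<ge> 2" using prime_ge_2_nat[of p] by auto
      have "ln (real p powr (1/2)) \<le> real p powr (1/2)" using p by (intro less_imp_le ln_less_self) auto
      then have l: "ln (real p) \<le> 2 * real p powr (1/2)" using p by (simp add: ln_powr)
      have "ln (real p) / (real p * (real p - 1)) \<le> 2 * real p powr (1/2) / (real p * (real p / 2))"
        using l p by (intro frac_le mult_left_mono) auto
      also have "\<dots> = 4 * (real p powr (1/2) / real p ^ 2)" by (simp add: power2_eq_square)
      also have "\<dots> = 4 * real p powr (1/2 - 2)" using p by (subst powr_diff) simp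
      finally show "ln (real p) / (real p * (real p - 1)) \<le> 4 * real p powr (- 3 / 2)" by simp
    qed
    also have "\<dots> \<le> C" unfolding C_def by (intro sum_le_suminf sm) auto
    finally show ?thesis .
  qed
  moreover have "C \<ge> 0" unfolding C_def by (intro suminf_nonneg sm) auto
  ultimately show ?thesis by blast
qed

text \<open>The exponent of \<open>p\<close> in \<open>fact n\<close> is at most
  \<open>n / (p - 1)\<close>, which is \<open>n / p\<close> plus a part that sums to
  \<open>O(n)\<close> by \<open>sum_ln_div_square_le\<close>. Compare with
  \<open>ln_fact_ge\<close>.\<close>

lemma mertens_ge: "\<exists>C\<ge>0. \<forall>n\<ge>1. mertens n \<ge> ln n - C"
proof -
  obtain C where C: "C \<ge> 0" "\<And>n. (\<Sum>p | prime p \<and> p \<le> n. ln (real p) / (real p * (real p - 1))) \<le> C"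
    using sum_ln_div_square_le by blast
  have "mertens n \<ge> ln n - (C + 1)" if n: "n \<ge> 1" for n
  proof -
    have "real n * ln n - real n \<le> ln (fact n)" by (rule ln_fact_ge)
    also have "\<dots> \<le> (\<Sum>p | prime p \<and> p \<le> n. real n * (ln (real p) / p + ln (real p) / (real p * (real p - 1))))"
      unfolding ln_fact_eq
    proof (intro sum_mono)
      fix p assume "p \<in> {p. prime p \<and> p \<le> n}"
      then have p: "prime p" by simp
      then have p2: "real p \<ge> 2" using prime_ge_2_nat[of p] by auto
      have "real (multiplicity p (fact n :: nat)) \<le> real n / (real p - 1)"
        using multiplicity_fact_le[OF p, of n] p2 by (simp add: field_simps)
      also have "\<dots> = real n * (1 / p + 1 / (real p * (real p - 1)))" using p2 by (simp add: field_simps)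
      finally have "real (multiplicity p (fact n :: nat)) * ln p \<le> real n * (1 / p + 1 / (real p * (real p - 1))) * ln p"
        using p2 by (intro mult_right_mono) auto
      then show "real (multiplicity p (fact n :: nat)) * ln p \<le> real n * (ln (real p) / p + ln (real p) / (real p * (real p - 1)))"
        by (simp add: algebra_simps)
    qed
    also have "\<dots> = real n * (mertens n + (\<Sum>p | prime p \<and> p \<le> n. ln (real p) / (real p * (real p - 1))))"
      by (simp add: mertens_def sum_distrib_left sum.distrib distrib_left)
    also have "\<dots> \<le> real n * (mertens n + C)" by (intro mult_left_mono add_left_mono C) auto
    finally have "real n * (ln n - 1) \<le> real n * (mertens n + C)" by (simp add: algebra_simps)
    then show ?thesis using n by simp
  qed
  then show ?thesis using C(1) by (intro exI[of _ "C + 1"]) auto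
qed

section \<open>Prime sums with exponent slightly below 1\<close>

definition prime_sum :: "nat \<Rightarrow> real \<Rightarrow> real" where
  "prime_sum n \<sigma> = (\<Sum>p | prime p \<and> p \<le> n. ln (real p) * real p powr (- \<sigma>))"

lemma sum_primes_le_Suc:
  fixes f :: "nat \<Rightarrow> real"
  shows "(\<Sum>p | prime p \<and> p \<le> Suc n. f p) = (\<Sum>p | prime p \<and> p \<le> n. f p) + (if prime (Suc n) then f (Suc n) else 0)"
proof (cases "prime (Suc n)")
  case True
  then have "{p. prime p \<and> p \<le> Suc n} = insert (Suc n) {p. prime p \<and> p \<le> n}" by (auto simp: le_Suc_eq)
  then show ?thesis using True by simp
next
  case False
  then have "{p. prime p \<and> p \<le> Suc n} = {p. prime p \<and> p \<le> n}" by (auto simp: le_Suc_eq)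
  then show ?thesis using False by simp
qed

text \<open>Partial summation against \<open>mertens\<close>, carried out as an induction on \<open>n\<close>.\<close>

lemma prime_sum_ge:
  "\<exists>C\<ge>0. \<forall>n\<ge>1. \<forall>\<delta>>0. prime_sum n (1 - \<delta>) \<ge> (real n powr \<delta> - 1) / \<delta> - C * real n powr \<delta>"
proof -
  obtain C0 where C0: "C0 \<ge> 0" "\<And>n. n \<ge> 1 \<Longrightarrow> mertens n \<ge> ln n - C0" using mertens_ge by blast
  define C where "C = C0 + 6"
  have up: "mertens n \<le> ln n + C" and lo: "mertens n \<ge> ln n - C" if "n \<ge> 1" for n
    using mertens_le[OF that] C0(2)[OF that] C0(1) by (auto simp: C_def)
  \<comment> \<open>The left side is minus the integral of \<open>mertens u\<close> against
    \<open>d(u powr \<delta>)\<close>. With \<open>ln u + C\<close> in place of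
    \<open>mertens u\<close> this integral evaluates to the right side plus \<open>C\<close>. The
    induction step thus uses the upper bound \<open>up\<close> only.\<close>
  have step: "prime_sum n (1 - \<delta>) - mertens n * real n powr \<delta> \<ge> (real n powr \<delta> - 1) / \<delta> - ln n * real n powr \<delta> - C * real n powr \<delta>"
    if n: "n \<ge> 1" and d: "\<delta> > 0" for n :: nat and \<delta> :: real
    using n
  proof (induction n rule: dec_induct)
    case base
    show ?case using C0(1) by (simp add: prime_sum_def mertens_def C_def no_primes_le_1)
  next
    case (step n)
    define g where "g = real n powr \<delta>"
    define h where "h = real (Suc n) powr \<delta>"
    have gh: "g \<le> h" unfolding g_def h_def using d by (intro powr_mono2) auto
    have P: "prime_sum (Suc n) (1 - \<delta>) = prime_sum n (1 - \<delta>) + (mertens (Suc n) - mertens n) * h"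
      unfolding prime_sum_def mertens_def sum_primes_le_Suc h_def
      by (simp add: powr_diff field_simps del: of_nat_Suc)
    have "mertens n * (h - g) \<le> (ln n + C) * (h - g)" using gh up[of n] step by (intro mult_right_mono) auto
    moreover have "(h - g) / \<delta> \<le> h * (ln (Suc n) - ln n)"
    proof -
      have "g = h * exp (- (\<delta> * (ln (Suc n) - ln n)))"
        using step by (simp add: g_def h_def powr_def algebra_simps flip: exp_add)
      moreover have "exp (- (\<delta> * (ln (Suc n) - ln n))) \<ge> 1 + - (\<delta> * (ln (Suc n) - ln n))"
        by (rule exp_ge_add_one_self)
      moreover have "h > 0" by (simp add: h_def)
      ultimately have "g \<ge> h * (1 + - (\<delta> * (ln (Suc n) - ln n)))" by simp
      then show ?thesis using d by (simp add: field_simps)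
    qed
    moreover have "(h - 1) / \<delta> = (g - 1) / \<delta> + (h - g) / \<delta>" by (simp add: diff_divide_distrib)
    ultimately show ?case using step.IH unfolding P g_def[symmetric] h_def[symmetric] by (simp add: algebra_simps)
  qed
  have "prime_sum n (1 - \<delta>) \<ge> (real n powr \<delta> - 1) / \<delta> - (2 * C) * real n powr \<delta>" if n: "n \<ge> 1" and d: "\<delta> > 0" for n \<delta>
  proof -
    \<comment> \<open>The lower bound for \<open>mertens\<close> cancels
      \<open>ln n * n powr \<delta>\<close>, at the cost of a second \<open>C\<close>.\<close>
    have "mertens n * real n powr \<delta> \<ge> (ln n - C) * real n powr \<delta>" using lo[OF n] by (intro mult_right_mono) auto
    then show ?thesis using step[OF n d] by (simp add: algebra_simps)
  qed
  moreover have "2 * C \<ge> 0" using C0 by (simp add: C_def)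
  ultimately show ?thesis by blast
qed

section \<open>The resonator\<close>

text \<open>Jordan's totient function with real exponent \<open>\<sigma>\<close>, the Moebius
  inverse of \<open>n powr \<sigma>\<close>. These are the resonator coefficients
  \<open>r d\<close>; the product form makes their nonnegativity visible.\<close>

definition gtot :: "real \<Rightarrow> nat \<Rightarrow> real" where
  "gtot \<sigma> d = real d powr \<sigma> * (\<Prod>p\<in>prime_factors d. 1 - real p powr (- \<sigma>))"

lemma one_minus_prime_powr:
  assumes "prime (p :: nat)" "\<sigma> \<ge> 0"
  shows "0 \<le> 1 - real p powr (- \<sigma>)" "1 - real p powr (- \<sigma>) \<le> 1"
  using powr_mono[of "- \<sigma>" 0 "real p"] assms prime_ge_1_nat[of p] by auto

lemma gtot_bounds:
  assumes "\<sigma> \<ge> 0"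
  shows "gtot \<sigma> d \<ge> 0" "gtot \<sigma> d \<le> real d powr \<sigma>"
proof -
  have "(\<Prod>p\<in>prime_factors d. 1 - real p powr (- \<sigma>)) \<in> {0..1}"
    using assms by (auto intro!: prod_nonneg prod_le_1 one_minus_prime_powr simp del: diff_ge_0_iff_ge diff_le_eq)
  then show "gtot \<sigma> d \<ge> 0" "gtot \<sigma> d \<le> real d powr \<sigma>"
    by (auto simp: gtot_def intro!: mult_left_le)
qed

lemma gtot_prime_power_mult:
  assumes p: "prime p" and d: "\<not> p dvd d" "d > 0"
  shows "gtot \<sigma> (p ^ Suc k * d) = (real (p ^ Suc k) powr \<sigma> - real (p ^ k) powr \<sigma>) * gtot \<sigma> d"
proof -
  have "prime_factors (p ^ Suc k * d) = insert p (prime_factors d)"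
  proof -
    have "x dvd p ^ Suc k * d \<longleftrightarrow> x = p \<or> x dvd d" if "prime x" for x
      using that p by (metis prime_dvd_mult_iff prime_dvd_power primes_dvd_imp_eq dvd_power zero_less_Suc)
    then show ?thesis using p d prime_gt_0_nat[OF p] by (auto simp: prime_factors_dvd simp del: power_Suc)
  qed
  moreover have "p \<notin> prime_factors d" using d by (auto simp: prime_factors_dvd)
  ultimately have "gtot \<sigma> (p ^ Suc k * d) = (real (p ^ Suc k) powr \<sigma> * (1 - real p powr (- \<sigma>))) * gtot \<sigma> d"
    by (simp add: gtot_def powr_mult mult_ac del: power_Suc)
  also have "real (p ^ Suc k) powr \<sigma> * (1 - real p powr (- \<sigma>)) = real (p ^ Suc k) powr \<sigma> - real (p ^ k) powr \<sigma>"
    using prime_gt_0_nat[OF p] by (simp add: powr_mult powr_minus field_simps)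
  finally show ?thesis .
qed

text \<open>Write \<open>n = p ^ (j + 1) * m\<close> with \<open>p\<close> not dividing
  \<open>m\<close>. A divisor of \<open>n\<close> either divides \<open>n div p\<close> or is
  \<open>p ^ (j + 1)\<close> times a divisor of \<open>m\<close>. By
  \<open>gtot_prime_power_mult\<close> and induction the second kind contributes
  \<open>n powr \<sigma> - (n div p) powr \<sigma>\<close>.\<close>

lemma sum_gtot_divisors:
  assumes "n > 0"
  shows "(\<Sum>d | d dvd n. gtot \<sigma> d) = real n powr \<sigma>"
  using assms
proof (induction n rule: less_induct)
  case (less n)
  show ?case
  proof (cases "n = 1")
    case True
    have "{d :: nat. d dvd 1} = {1}" by auto
    then show ?thesis using True by (simp add: gtot_def)
  next
    case False
    then obtain p where p: "prime p" "p dvd n" using prime_factor_nat by blast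
    define k where "k = multiplicity p n"
    obtain m where m: "n = p ^ k * m" "\<not> p dvd m"
      using multiplicity_decompose'[of n p] less.prems p not_prime_unit[of p] unfolding k_def by blast
    have "k > 0" using p less.prems by (simp add: k_def prime_multiplicity_gt_zero_iff)
    then obtain j where j: "k = Suc j" by (cases k) auto
    have p1: "p > 1" using p(1) by (rule prime_gt_1_nat)
    have m0: "m > 0" using less.prems m by (cases m) auto
    define n' where "n' = p ^ j * m"
    have n': "n = p * n'" "n' < n" "n' > 0" using m j m0 p1 less.prems by (auto simp: n'_def)
    have fin: "finite {d. d dvd n'}" "finite {d. d dvd m}" using n' m0 by auto
    have split: "{d. d dvd n} = {d. d dvd n'} \<union> (\<lambda>d. p ^ Suc j * d) ` {d. d dvd m}"
    proof (intro set_eqI iffI)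
      fix d assume "d \<in> {d. d dvd n}"
      then have d: "d dvd n" by simp
      then have "d > 0" using less.prems by (auto intro: Nat.gr0I)
      obtain e where e: "d = p ^ multiplicity p d * e" "\<not> p dvd e"
        using multiplicity_decompose'[of d p] \<open>d > 0\<close> p(1) not_prime_unit[of p] by blast
      define i where "i = multiplicity p d"
      have "i \<le> Suc j" using dvd_imp_multiplicity_le[OF d, of p] less.prems j by (simp add: i_def k_def)
      have cop: "coprime e (p ^ Suc j)" using e(2) p(1) by (metis coprime_commute coprime_power_left_iff prime_imp_coprime)
      have "e dvd p ^ Suc j * m" using d e(1) m(1) j by (metis dvd_mult_right)
      then have em: "e dvd m" using cop by (simp only: coprime_dvd_mult_right_iff)
      show "d \<in> {d. d dvd n'} \<union> (\<lambda>d. p ^ Suc j * d) ` {d. d dvd m}"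
      proof (cases "i = Suc j")
        case True
        then show ?thesis using e em by (auto simp: i_def)
      next
        case False
        then have "i \<le> j" using \<open>i \<le> Suc j\<close> by simp
        then have "d dvd n'" unfolding n'_def using e(1) em by (metis i_def le_imp_power_dvd mult_dvd_mono)
        then show ?thesis by simp
      qed
    next
      fix d assume "d \<in> {d. d dvd n'} \<union> (\<lambda>d. p ^ Suc j * d) ` {d. d dvd m}"
      moreover have "n' dvd n" using n'(1) by simp
      ultimately show "d \<in> {d. d dvd n}" unfolding m(1) j by (auto intro: dvd_trans)
    qed
    have "{d. d dvd n'} \<inter> (\<lambda>d. p ^ Suc j * d) ` {d. d dvd m} = {}"
    proof -
      have False if "p ^ Suc j * d dvd n'" for d
      proof -
        have "p ^ j * p dvd p ^ j * m" using that by (auto simp: n'_def mult.commute intro: dvd_mult_left)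
        then have "p dvd m" using p1 by simp
        then show False using m by simp
      qed
      then show ?thesis by auto
    qed
    then have "(\<Sum>d | d dvd n. gtot \<sigma> d) = (\<Sum>d | d dvd n'. gtot \<sigma> d) + (\<Sum>d\<in>(\<lambda>d. p ^ Suc j * d) ` {d. d dvd m}. gtot \<sigma> d)"
      unfolding split using fin by (intro sum.union_disjoint) auto
    also have "(\<Sum>d\<in>(\<lambda>d. p ^ Suc j * d) ` {d. d dvd m}. gtot \<sigma> d) = (\<Sum>d | d dvd m. gtot \<sigma> (p ^ Suc j * d))"
      using p1 by (intro sum.reindex_cong[of "\<lambda>d. p ^ Suc j * d"]) (auto simp: inj_on_def)
    also have "\<dots> = (\<Sum>d | d dvd m. (real (p ^ Suc j) powr \<sigma> - real (p ^ j) powr \<sigma>) * gtot \<sigma> d)"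
      using p(1) m m0 by (intro sum.cong refl gtot_prime_power_mult) (auto intro: Nat.gr0I dest: dvd_trans)
    also have "\<dots> = (real (p ^ Suc j) powr \<sigma> - real (p ^ j) powr \<sigma>) * real m powr \<sigma>"
    proof -
      have "m dvd n'" by (simp add: n'_def)
      then have "m < n" using dvd_imp_le n'(2,3) by (meson le_less_trans)
      from less.IH[OF this m0] show ?thesis by (simp add: sum_distrib_left[symmetric])
    qed
    also have "(\<Sum>d | d dvd n'. gtot \<sigma> d) = real n' powr \<sigma>" using n' by (intro less.IH) auto
    also have "real n' powr \<sigma> + (real (p ^ Suc j) powr \<sigma> - real (p ^ j) powr \<sigma>) * real m powr \<sigma> = real n powr \<sigma>"
      unfolding n'_def m(1) j by (simp add: powr_mult algebra_simps)
    finally show ?thesis .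
  qed
qed

text \<open>Multiplication by \<open>p, \<dots>, p ^ E\<close> maps the divisors of \<open>Q\<close> prime to \<open>p\<close> to further,
  pairwise different, divisors of \<open>Q\<close>.\<close>

lemma card_divisors_not_dvd:
  fixes Q :: nat
  assumes p: "prime p" and pQ: "p ^ E dvd Q" and Q: "Q > 0"
  shows "(E + 1) * card {m. m dvd Q \<and> \<not> p dvd m} \<le> card {m. m dvd Q}"
proof -
  let ?f = "\<lambda>(j, m). p ^ j * m"
  have m: "multiplicity p (p ^ j * m) = j" if "\<not> p dvd m" for j m :: nat
    using that p by (intro multiplicity_eqI) (auto simp: prime_gt_0_nat)
  have "inj_on ?f ({..E} \<times> {m. m dvd Q \<and> \<not> p dvd m})"
  proof (rule inj_onI, clarify)
    fix i j m n
    assume h: "\<not> p dvd m" "\<not> p dvd n" "p ^ i * m = p ^ j * n"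
    then have "i = j" using m by metis
    then show "i = j \<and> m = n" using h(3) prime_gt_0_nat[OF p] by simp
  qed
  moreover have "?f ` ({..E} \<times> {m. m dvd Q \<and> \<not> p dvd m}) \<subseteq> {m. m dvd Q}"
  proof clarify
    fix j m assume h: "j \<le> E" "m dvd Q" "\<not> p dvd m"
    have "p ^ j dvd Q" using h(1) pQ by (meson dvd_trans le_imp_power_dvd)
    moreover have "coprime (p ^ j) m" using h(3) p by (metis coprime_power_left_iff prime_imp_coprime)
    ultimately show "p ^ j * m dvd Q" using h(2) by (simp add: divides_mult)
  qed
  ultimately have "card ({..E} \<times> {m. m dvd Q \<and> \<not> p dvd m}) \<le> card {m. m dvd Q}"
    using Q by (intro card_inj_on_le) auto
  then show ?thesis by (simp add: card_cartesian_product)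
qed

text \<open>The involution \<open>m \<mapsto> Q div m\<close> on the divisors of \<open>Q\<close>
  reduces this to \<open>card_divisors_not_dvd\<close>.\<close>

lemma card_divisors_not_dvd_codivisor:
  fixes Q :: nat
  assumes p: "prime p" and pQ: "p ^ E dvd Q" and Q: "Q > 0"
  shows "(E + 1) * card {m. m dvd Q \<and> \<not> p dvd Q div m} \<le> card {m. m dvd Q}"
proof -
  have "card {m. m dvd Q \<and> \<not> p dvd Q div m} = card {m. m dvd Q \<and> \<not> p dvd m}"
    by (rule bij_betw_same_card[of "\<lambda>m. Q div m"], rule bij_betw_byWitness[of _ "\<lambda>m. Q div m"])
       (use Q in \<open>auto simp: div_div_eq_right dvd_div_eq_mult\<close>)
  then show ?thesis using card_divisors_not_dvd[OF assms] by simp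
qed

text \<open>A truncated Dirichlet convolution. For \<open>d dvd n\<close> the condition
  \<open>n \<le> X * d\<close> says that the cofactor \<open>n div d\<close> is in the range of
  \<open>dpoly X w\<close>, which makes \<open>dpoly_mult_div_poly\<close> an exact
  identity.\<close>

definition conv_coeff :: "nat \<Rightarrow> nat \<Rightarrow> (nat \<Rightarrow> real) \<Rightarrow> (nat \<Rightarrow> real) \<Rightarrow> nat \<Rightarrow> real" where
  "conv_coeff X Q r w n = (\<Sum>d | d dvd Q \<and> d dvd n \<and> n \<le> X * d. r d * w (n div d))"

definition div_poly :: "nat \<Rightarrow> (nat \<Rightarrow> real) \<Rightarrow> complex \<Rightarrow> complex" where
  "div_poly Q r s = (\<Sum>d | d dvd Q. of_real (r d) * of_nat d powr (- s))"

lemma dpoly_mult_div_poly: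
  assumes Q: "Q > 0"
  shows "dpoly X w s * div_poly Q r s = dpoly (X * Q) (conv_coeff X Q r w) s"
proof -
  have fin: "finite {d. d dvd Q}" using Q by simp
  have "dpoly (X * Q) (conv_coeff X Q r w) s = (\<Sum>n\<in>{1..X * Q}. \<Sum>d | d \<in> {d. d dvd Q} \<and> d dvd n \<and> n \<le> X * d. of_real (r d * w (n div d)) * of_nat n powr (- s))"
    by (simp add: dpoly_def conv_coeff_def sum_distrib_right)
  also have "\<dots> = (\<Sum>d | d dvd Q. \<Sum>n | n \<in> {1..X * Q} \<and> d dvd n \<and> n \<le> X * d. of_real (r d * w (n div d)) * of_nat n powr (- s))"
    using fin by (intro sum.swap_restrict) auto
  also have "\<dots> = (\<Sum>d | d dvd Q. \<Sum>m\<in>{1..X}. of_real (r d * w m) * of_nat (m * d) powr (- s))"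
  proof (rule sum.cong[OF refl])
    fix d assume "d \<in> {d. d dvd Q}"
    then have d: "d dvd Q" "d > 0" "d \<le> Q" using Q by (auto intro: Nat.gr0I dvd_imp_le)
    show "(\<Sum>n | n \<in> {1..X * Q} \<and> d dvd n \<and> n \<le> X * d. of_real (r d * w (n div d)) * of_nat n powr (- s)) =
      (\<Sum>m\<in>{1..X}. of_real (r d * w m) * (of_nat (m * d) :: complex) powr (- s))"
    proof (rule sum.reindex_bij_witness[of _ "\<lambda>m. m * d" "\<lambda>n. n div d"])
      fix n assume "n \<in> {n. n \<in> {1..X * Q} \<and> d dvd n \<and> n \<le> X * d}"
      then show "n div d \<in> {1..X}" using d by (auto simp: div_le_dividend less_eq_div_iff_mult_less_eq dvd_imp_le elim!: dvdE)
    next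
      fix m assume "m \<in> {1..X}"
      then show "m * d \<in> {n. n \<in> {1..X * Q} \<and> d dvd n \<and> n \<le> X * d}"
        using d by (auto intro!: mult_le_mono)
    qed (use d in auto)
  qed
  also have "\<dots> = (\<Sum>d | d dvd Q. \<Sum>m\<in>{1..X}. (of_real (w m) * of_nat m powr (- s)) * (of_real (r d) * of_nat d powr (- s)))"
    by (intro sum.cong refl) (simp add: powr_times_real mult.assoc mult.left_commute)
  also have "\<dots> = dpoly X w s * div_poly Q r s"
    unfolding dpoly_def div_poly_def sum_product by (rule sum.swap)
  finally show ?thesis ..
qed

lemma conv_coeff_nonneg:
  assumes "\<And>d. r d \<ge> 0" "\<And>m. w m \<ge> 0"
  shows "conv_coeff X Q r w n \<ge> 0"
  unfolding conv_coeff_def using assms by (intro sum_nonneg) simp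

context
  fixes \<sigma> :: real and Q :: nat
  assumes \<sigma>: "\<sigma> \<ge> 0" and Q: "Q > 0"
begin

text \<open>Dropping the length condition only adds nonnegative terms; then \<open>d\<close> runs
  through the divisors of \<open>gcd n Q\<close>, where \<open>sum_gtot_divisors\<close>
  applies.\<close>

lemma conv_gtot_le:
  assumes w: "\<And>m. m \<ge> 1 \<Longrightarrow> m \<le> n \<Longrightarrow> 0 \<le> w m \<and> w m \<le> W" and n: "n > 0" and W: "W \<ge> 0"
  shows "conv_coeff X Q (gtot \<sigma>) w n \<le> real (gcd n Q) powr \<sigma> * W"
proof -
  have fin: "finite {d. d dvd gcd n Q}" using Q by simp
  have "conv_coeff X Q (gtot \<sigma>) w n \<le> (\<Sum>d | d dvd Q \<and> d dvd n \<and> n \<le> X * d. gtot \<sigma> d * W)"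
    unfolding conv_coeff_def
    using n by (intro sum_mono mult_left_mono gtot_bounds \<sigma>) (use w in \<open>auto simp: div_greater_zero_iff dvd_imp_le Suc_le_eq intro!: div_le_dividend\<close>)
  also have "\<dots> \<le> (\<Sum>d | d dvd gcd n Q. gtot \<sigma> d * W)"
    by (rule sum_mono2[OF fin]) (auto intro!: mult_nonneg_nonneg gtot_bounds \<sigma> W)
  also have "\<dots> = real (gcd n Q) powr \<sigma> * W"
    using sum_gtot_divisors[of "gcd n Q" \<sigma>] Q by (simp add: sum_distrib_right[symmetric])
  finally show ?thesis .
qed

lemma conv_gtot_div_eq:
  assumes n: "n dvd Q" and X: "Q \<le> X"
  shows "conv_coeff X Q (gtot \<sigma>) w n = (\<Sum>d | d dvd n. gtot \<sigma> d * w (n div d))"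
proof -
  have "n \<le> X * d" if "d dvd n" for d
  proof -
    have "d > 0" using that n Q by (auto intro!: Nat.gr0I)
    moreover have "n \<le> X" using n Q X dvd_imp_le le_trans by blast
    ultimately show ?thesis by (metis One_nat_def Suc_leI le_trans mult.right_neutral mult_le_mono2)
  qed
  then have "{d. d dvd Q \<and> d dvd n \<and> n \<le> X * d} = {d. d dvd n}" using n dvd_trans by blast
  then show ?thesis by (simp add: conv_coeff_def)
qed

lemma conv_gtot_one_eq:
  assumes n: "n dvd Q" and X: "Q \<le> X"
  shows "conv_coeff X Q (gtot \<sigma>) (\<lambda>_. 1) n = real n powr \<sigma>"
  using conv_gtot_div_eq[OF assms] sum_gtot_divisors[of n \<sigma>] n Q by (auto intro!: Nat.gr0I)

text \<open>\<open>ln (n div d)\<close> is at least the sum of \<open>ln p\<close> over the primes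
  \<open>p\<close> dividing \<open>n div d\<close>. After interchanging sums,
  \<open>p dvd n div d\<close> means \<open>d dvd n div p\<close>, so the sum of \<open>gtot\<close>
  over these \<open>d\<close> is \<open>(n / p) powr \<sigma>\<close>.\<close>

lemma conv_gtot_ln_ge:
  assumes n: "n dvd Q" and X: "Q \<le> X"
  shows "conv_coeff X Q (gtot \<sigma>) (\<lambda>m. ln (real m)) n \<ge> (\<Sum>p\<in>prime_factors n. ln (real p) * (real n / real p) powr \<sigma>)"
proof -
  have n0: "n > 0" using n Q by (auto intro!: Nat.gr0I)
  have fin: "finite {d. d dvd n}" using n0 by simp
  have "(\<Sum>p\<in>prime_factors n. ln (real p) * (real n / real p) powr \<sigma>) = (\<Sum>p\<in>prime_factors n. \<Sum>d | d \<in> {d. d dvd n} \<and> p dvd n div d. gtot \<sigma> d * ln (real p))"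
  proof (rule sum.cong[OF refl])
    fix p assume "p \<in> prime_factors n"
    then have p: "prime p" "p dvd n" by auto
    have "p > 0" using p prime_gt_0_nat by auto
    obtain m where m: "n = p * m" using p(2) by blast
    have "m > 0" using m n0 by (auto intro!: Nat.gr0I)
    have "d dvd p * m \<and> p dvd p * m div d \<longleftrightarrow> d dvd m" for d
    proof
      assume h: "d dvd p * m \<and> p dvd p * m div d"
      then obtain e where e: "p * m = d * e" by blast
      have "d > 0" using e \<open>p > 0\<close> \<open>m > 0\<close> by (auto intro!: Nat.gr0I)
      then have "p dvd e" using h e by simp
      then obtain f where "e = p * f" by blast
      then have "m = d * f" using e \<open>p > 0\<close> by simp
      then show "d dvd m" by simp
    next
      assume "d dvd m"
      then obtain f where f: "m = d * f" by blast
      have "d > 0" using f \<open>m > 0\<close> by (auto intro!: Nat.gr0I)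
      then show "d dvd p * m \<and> p dvd p * m div d" unfolding f by (auto simp: mult.left_commute[of p])
    qed
    then have "{d. d \<in> {d. d dvd n} \<and> p dvd n div d} = {d. d dvd m}" unfolding m by simp
    then show "ln (real p) * (real n / real p) powr \<sigma> = (\<Sum>d | d \<in> {d. d dvd n} \<and> p dvd n div d. gtot \<sigma> d * ln (real p))"
      using sum_gtot_divisors[OF \<open>m > 0\<close>, of \<sigma>] \<open>p > 0\<close> m by (simp add: sum_distrib_right[symmetric])
  qed
  also have "\<dots> = (\<Sum>d | d dvd n. \<Sum>p | p \<in> prime_factors n \<and> p dvd n div d. gtot \<sigma> d * ln (real p))"
    using fin by (intro sum.swap_restrict) auto
  also have "\<dots> \<le> (\<Sum>d | d dvd n. gtot \<sigma> d * ln (real (n div d)))"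
  proof (intro sum_mono)
    fix d assume "d \<in> {d. d dvd n}"
    then have nd: "n div d > 0" using n0 by (auto simp: div_greater_zero_iff dvd_imp_le intro!: Nat.gr0I)
    define P where "P = {p. p \<in> prime_factors n \<and> p dvd n div d}"
    have P: "finite P" "\<And>p. p \<in> P \<Longrightarrow> prime p" "\<And>p. p \<in> P \<Longrightarrow> p dvd n div d" by (auto simp: P_def)
    have "\<Prod>P \<le> n div d" using prod_primes_dvd[OF P] nd by (rule dvd_imp_le)
    moreover have "\<Prod>P > 0" using P(2) by (intro prod_pos) (auto simp: prime_gt_0_nat)
    ultimately have "ln (real (\<Prod>P)) \<le> ln (real (n div d))" using nd by (subst ln_le_cancel_iff) (auto simp del: of_nat_prod)
    then have "(\<Sum>p\<in>P. ln (real p)) \<le> ln (real (n div d))" using ln_prod_primes[OF P(1,2)] by simp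
    then show "(\<Sum>p | p \<in> prime_factors n \<and> p dvd n div d. gtot \<sigma> d * ln (real p)) \<le> gtot \<sigma> d * ln (real (n div d))"
      unfolding sum_distrib_left[symmetric] P_def[symmetric] by (intro mult_left_mono gtot_bounds \<sigma>)
  qed
  also have "\<dots> = conv_coeff X Q (gtot \<sigma>) (\<lambda>m. ln (real m)) n" by (rule conv_gtot_div_eq[OF assms, symmetric])
  finally show ?thesis .
qed

section \<open>Diagonal terms of the two mean values\<close>

abbreviation "\<tau> \<equiv> card {d. d dvd Q}"

text \<open>All terms are nonnegative, so only the divisors \<open>n\<close> of \<open>Q\<close> are
  kept. By \<open>conv_gtot_ln_ge\<close> each contributes at least
  \<open>ln p * p powr (- \<sigma>)\<close> for every prime \<open>p \<le> Y\<close> dividing it,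
  and \<open>p\<close> divides all but a proportion \<open>1 / (E + 1)\<close> of the divisors of
  \<open>Q\<close>.\<close>

lemma numerator_ge:
  assumes E: "\<And>p. prime p \<Longrightarrow> p \<le> Y \<Longrightarrow> p ^ E dvd Q" and X: "Q \<le> X"
  shows "(\<Sum>n\<in>{1..X * Q}. conv_coeff X Q (gtot \<sigma>) (\<lambda>m. ln (real m)) n * conv_coeff X Q (gtot \<sigma>) (\<lambda>_. 1) n * real n powr (- 2 * \<sigma>))
     \<ge> real \<tau> * (1 - 1 / real (E + 1)) * prime_sum Y \<sigma>"
proof -
  let ?b = "conv_coeff X Q (gtot \<sigma>) (\<lambda>m. ln (real m))"
  let ?a = "conv_coeff X Q (gtot \<sigma>) (\<lambda>_. 1)"
  let ?D = "{d. d dvd Q}" and ?P = "{p :: nat. prime p \<and> p \<le> Y}"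
  have fin: "finite ?D" using Q by simp
  have lnn: "0 \<le> ln (real m)" for m by (cases "m = 0") auto
  have "real \<tau> * (1 - 1 / real (E + 1)) * prime_sum Y \<sigma> = (\<Sum>p\<in>?P. (real \<tau> * (1 - 1 / real (E + 1))) * (ln (real p) * real p powr (- \<sigma>)))"
    by (simp add: prime_sum_def sum_distrib_left)
  also have "\<dots> \<le> (\<Sum>p\<in>?P. real (card {n. n \<in> ?D \<and> p dvd n}) * (ln (real p) * real p powr (- \<sigma>)))"
  proof (intro sum_mono mult_right_mono mult_nonneg_nonneg lnn)
    fix p assume "p \<in> ?P"
    then have p: "prime p" "p ^ E dvd Q" using E by auto
    define c where "c = card {n. n dvd Q \<and> \<not> p dvd n}"
    have "card ({n. n \<in> ?D \<and> p dvd n} \<union> {n. n dvd Q \<and> \<not> p dvd n}) = card {n. n \<in> ?D \<and> p dvd n} + c"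
      unfolding c_def using Q by (intro card_Un_disjoint) auto
    moreover have "{n. n \<in> ?D \<and> p dvd n} \<union> {n. n dvd Q \<and> \<not> p dvd n} = ?D" by auto
    ultimately have "\<tau> = card {n. n \<in> ?D \<and> p dvd n} + c" by simp
    moreover have "(E + 1) * c \<le> \<tau>" unfolding c_def by (rule card_divisors_not_dvd[OF p Q])
    then have "real (E + 1) * real c \<le> real \<tau>" by (metis of_nat_le_iff of_nat_mult)
    then have "real c \<le> real \<tau> / real (E + 1)" by (simp add: field_simps del: of_nat_Suc)
    ultimately show "real \<tau> * (1 - 1 / real (E + 1)) \<le> real (card {n. n \<in> ?D \<and> p dvd n})"
      by (simp add: algebra_simps add_divide_distrib)
  qed simp
  also have "\<dots> = (\<Sum>p\<in>?P. \<Sum>n | n \<in> ?D \<and> p dvd n. ln (real p) * real p powr (- \<sigma>))"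
    by (simp only: sum_constant)
  also have "\<dots> = (\<Sum>n\<in>?D. \<Sum>p | p \<in> ?P \<and> p dvd n. ln (real p) * real p powr (- \<sigma>))"
    using fin by (intro sum.swap_restrict) auto
  also have "\<dots> \<le> (\<Sum>n\<in>?D. ?b n * ?a n * real n powr (- 2 * \<sigma>))"
  proof (rule sum_mono)
    fix n assume "n \<in> ?D"
    then have n: "n dvd Q" by simp
    then have n0: "n > 0" using Q by (auto intro!: Nat.gr0I)
    have "(\<Sum>p | p \<in> ?P \<and> p dvd n. ln (real p) * real p powr (- \<sigma>)) \<le> (\<Sum>p\<in>prime_factors n. ln (real p) * real p powr (- \<sigma>))"
      using n0 by (intro sum_mono2) (auto simp: prime_factors_dvd intro!: mult_nonneg_nonneg lnn)
    also have "\<dots> = (\<Sum>p\<in>prime_factors n. ln (real p) * (real n / real p) powr \<sigma>) * real n powr (- \<sigma>)"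
      unfolding sum_distrib_right using n0
      by (intro sum.cong refl) (auto simp: prime_factors_dvd powr_divide powr_minus field_simps prime_gt_0_nat)
    also have "\<dots> \<le> ?b n * real n powr (- \<sigma>)" by (intro mult_right_mono conv_gtot_ln_ge n X) auto
    also have "real n powr (- \<sigma>) = ?a n * real n powr (- 2 * \<sigma>)"
      unfolding conv_gtot_one_eq[OF n X] by (simp flip: powr_add)
    finally show "(\<Sum>p | p \<in> ?P \<and> p dvd n. ln (real p) * real p powr (- \<sigma>)) \<le> ?b n * ?a n * real n powr (- 2 * \<sigma>)"
      by (simp add: mult.assoc)
  qed
  also have "\<dots> \<le> (\<Sum>n\<in>{1..X * Q}. ?b n * ?a n * real n powr (- 2 * \<sigma>))"
  proof (rule sum_mono2)
    have "n \<le> X * Q" if "n dvd Q" for n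
    proof -
      have "n \<le> Q" using that Q by (rule dvd_imp_le)
      moreover have "1 * Q \<le> X * Q" using X Q by (intro mult_le_mono1) auto
      ultimately show ?thesis by linarith
    qed
    then show "?D \<subseteq> {1..X * Q}" using Q by (auto simp: Suc_le_eq intro!: Nat.gr0I)
  qed (auto intro!: mult_nonneg_nonneg conv_coeff_nonneg gtot_bounds \<sigma> lnn)
  finally show ?thesis .
qed

lemma sum_powr_le:
  assumes "X \<ge> 1" "\<sigma> \<ge> 3 / 4"
  shows "(\<Sum>k\<in>{X<..Z}. real k powr (- 2 * \<sigma>)) \<le> 2 * real X powr (- 1 / 2)"
proof -
  have sm: "summable (\<lambda>n. real (n + Suc X) powr (- 3 / 2))" and
    le: "(\<Sum>n. real (n + Suc X) powr (- 3 / 2)) \<le> 2 * real X powr (- 1 / 2)"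
    using powr_tail_sums[OF assms(1), of "1/2"] by simp_all
  have "(\<Sum>k\<in>{X<..Z}. real k powr (- 2 * \<sigma>)) \<le> (\<Sum>k\<in>{X<..Z}. real k powr (- 3 / 2))"
    using assms by (intro sum_mono powr_mono) auto
  also have "\<dots> = (\<Sum>n\<in>{..<Z - X}. real (n + Suc X) powr (- 3 / 2))"
    by (rule sum.reindex_bij_witness[of _ "\<lambda>n. n + Suc X" "\<lambda>k. k - Suc X"]) auto
  also have "\<dots> \<le> (\<Sum>n. real (n + Suc X) powr (- 3 / 2))"
    by (intro sum_le_suminf sm) auto
  also note le
  finally show ?thesis .
qed

text \<open>Each \<open>n\<close> is written as \<open>m * k\<close> with \<open>m = gcd n Q\<close>. Then \<open>k\<close> is prime to \<open>Q div m\<close>, which for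
  \<open>k > 1\<close> either forces \<open>k > Y\<close> or singles out a small proportion of the divisors \<open>m\<close>.\<close>

lemma denominator_le:
  assumes E: "\<And>p. prime p \<Longrightarrow> p \<le> Y \<Longrightarrow> p ^ E dvd Q" and Y: "Y \<ge> 1" and s: "\<sigma> \<ge> 3 / 4"
  shows "(\<Sum>n\<in>{1..Z}. conv_coeff X Q (gtot \<sigma>) (\<lambda>_. 1) n * conv_coeff X Q (gtot \<sigma>) (\<lambda>_. 1) n * real n powr (- 2 * \<sigma>))
     \<le> real \<tau> * (1 + 2 / real (E + 1) + 2 * real Y powr (- 1 / 2))"
proof -
  let ?a = "conv_coeff X Q (gtot \<sigma>) (\<lambda>_. 1)"
  let ?D = "{d. d dvd Q}"
  define w where "w k = real k powr (- 2 * \<sigma>)" for k :: nat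
  define M where "M k = {m. m dvd Q \<and> coprime k (Q div m)}" for k
  have fin: "finite ?D" using Q by simp
  have finM: "finite (M k)" for k by (rule finite_subset[OF _ fin]) (auto simp: M_def)
  \<comment> \<open>By \<open>conv_gtot_le\<close> the coefficient is at most
    \<open>gcd n Q powr \<sigma>\<close>, so the term is bounded by a weight in
    \<open>k = n div gcd n Q\<close> alone.\<close>
  have "(\<Sum>n\<in>{1..Z}. ?a n * ?a n * real n powr (- 2 * \<sigma>)) \<le> (\<Sum>n\<in>{1..Z}. w (n div gcd n Q))"
  proof (rule sum_mono)
    fix n assume n: "n \<in> {1..Z}"
    have "?a n \<le> real (gcd n Q) powr \<sigma>" using conv_gtot_le[of n "\<lambda>_. 1" 1 X] n by simp
    moreover have "?a n \<ge> 0" by (intro conv_coeff_nonneg gtot_bounds \<sigma>) simp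
    ultimately have "?a n * ?a n * real n powr (- 2 * \<sigma>) \<le> real (gcd n Q) powr \<sigma> * real (gcd n Q) powr \<sigma> * real n powr (- 2 * \<sigma>)"
      by (intro mult_right_mono mult_mono) auto
    also have "\<dots> = w (n div gcd n Q)"
    proof -
      define g where "g = gcd n Q"
      have g: "g > 0" using Q by (simp add: g_def)
      have "real n = real g * real (n div g)" by (simp add: g_def flip: of_nat_mult)
      then have "real n powr (- 2 * \<sigma>) = real g powr (- 2 * \<sigma>) * w (n div g)" by (simp add: w_def powr_mult)
      moreover have "real g powr \<sigma> * real g powr \<sigma> * real g powr (- 2 * \<sigma>) = 1"
        using g by (simp flip: powr_add)
      ultimately show ?thesis unfolding g_def[symmetric] by (simp add: mult.assoc[symmetric])
    qed
    finally show "?a n * ?a n * real n powr (- 2 * \<sigma>) \<le> w (n div gcd n Q)" .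
  qed
  also have "\<dots> = (\<Sum>(k, m)\<in>(\<lambda>n. (n div gcd n Q, gcd n Q)) ` {1..Z}. w k)"
  proof -
    have "inj_on (\<lambda>n. (n div gcd n Q, gcd n Q)) {1..Z}"
    proof (rule inj_onI)
      fix x y assume "(x div gcd x Q, gcd x Q) = (y div gcd y Q, gcd y Q)"
      then have *: "x div gcd x Q = y div gcd y Q" "gcd x Q = gcd y Q" by auto
      have "x = x div gcd x Q * gcd x Q" by simp
      also have "\<dots> = y div gcd y Q * gcd y Q" by (subst *(1), subst *(2)) (rule refl)
      finally show "x = y" by simp
    qed
    then show ?thesis by (simp only: sum.reindex o_def case_prod_conv)
  qed
  also have "\<dots> \<le> (\<Sum>(k, m)\<in>(SIGMA k:{1..Z}. M k). w k)"
  proof (rule sum_mono2)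
    show "finite (SIGMA k:{1..Z}. M k)" using finM by auto
    show "(\<lambda>n. (n div gcd n Q, gcd n Q)) ` {1..Z} \<subseteq> (SIGMA k:{1..Z}. M k)"
    proof (clarsimp simp: M_def)
      fix n assume n: "Suc 0 \<le> n" "n \<le> Z"
      have "gcd n Q \<le> n" using n by (intro gcd_le1_nat) auto
      then have "n div gcd n Q > 0" using Q by (simp add: div_greater_zero_iff)
      moreover have "n div gcd n Q \<le> Z" using n div_le_dividend le_trans by blast
      moreover have "coprime (n div gcd n Q) (Q div gcd n Q)" using Q by (intro div_gcd_coprime) auto
      ultimately show "Suc 0 \<le> n div gcd n Q \<and> n div gcd n Q \<le> Z \<and> coprime (n div gcd n Q) (Q div gcd n Q)" by simp
    qed
  qed (auto simp: w_def)
  also have "\<dots> = (\<Sum>k\<in>{1..Z}. real (card (M k)) * w k)"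
    using finM by (subst sum.Sigma[symmetric]) auto
  \<comment> \<open>\<open>k = 1\<close> admits all \<open>\<tau>\<close> divisors and gives the
    main term. For \<open>1 < k \<le> Y\<close> a prime factor of \<open>k\<close> leaves at most
    \<open>\<tau> / (E + 1)\<close> of them, and for \<open>k > Y\<close> the tail of
    \<open>w\<close> is small.\<close>
  also have "\<dots> \<le> (\<Sum>k\<in>{1..Z}. (if k = 1 then real \<tau> else 0) + ((if k > 1 then real \<tau> / real (E + 1) * w k else 0) + (if k > Y then real \<tau> * w k else 0)))"
  proof (rule sum_mono)
    fix k assume k: "k \<in> {1..Z}"
    have w0: "w k \<ge> 0" by (simp add: w_def)
    have M1: "real (card (M k)) \<le> real \<tau>"
      using fin by (auto simp: M_def intro!: card_mono)
    consider "k = 1" | "k > 1" "k > Y" | "k > 1" "k \<le> Y" using k by force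
    then show "real (card (M k)) * w k \<le> (if k = 1 then real \<tau> else 0) + ((if k > 1 then real \<tau> / real (E + 1) * w k else 0) + (if k > Y then real \<tau> * w k else 0))"
    proof cases
      case 1
      then show ?thesis using M1 by (simp add: w_def)
    next
      case 2
      then show ?thesis using mult_right_mono[OF M1 w0] w0 by (auto intro: add_increasing)
    next
      case 3
      then obtain p where p: "prime p" "p dvd k" using prime_factor_nat[of k] by auto
      have "p \<le> Y" using p 3 dvd_imp_le[of p k] by linarith
      have "M k \<subseteq> {m. m dvd Q \<and> \<not> p dvd Q div m}"
        using p not_prime_unit coprime_common_divisor unfolding M_def by blast
      then have "card (M k) \<le> card {m. m dvd Q \<and> \<not> p dvd Q div m}"
        by (rule card_mono[rotated]) (rule finite_subset[OF _ fin], auto)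
      then have "(E + 1) * card (M k) \<le> (E + 1) * card {m. m dvd Q \<and> \<not> p dvd Q div m}"
        by (rule mult_le_mono2)
      also have "\<dots> \<le> \<tau>" by (rule card_divisors_not_dvd_codivisor[OF p(1) E[OF p(1) \<open>p \<le> Y\<close>] Q])
      finally have "real (E + 1) * real (card (M k)) \<le> real \<tau>" by (metis of_nat_le_iff of_nat_mult)
      then have "real (card (M k)) \<le> real \<tau> / real (E + 1)" by (simp add: field_simps del: of_nat_Suc)
      from mult_right_mono[OF this w0] show ?thesis using 3 by simp
    qed
  qed
  also have "\<dots> = (\<Sum>k\<in>{1..Z}. if k = 1 then real \<tau> else 0) + ((\<Sum>k\<in>{1..Z}. if k > 1 then real \<tau> / real (E + 1) * w k else 0) + (\<Sum>k\<in>{1..Z}. if k > Y then real \<tau> * w k else 0))"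
    by (simp only: sum.distrib)
  also have "\<dots> \<le> real \<tau> + (real \<tau> / real (E + 1) * 2 + real \<tau> * (2 * real Y powr (- 1 / 2)))"
  proof (intro add_mono)
    show "(\<Sum>k\<in>{1..Z}. if k = 1 then real \<tau> else 0) \<le> real \<tau>" by (simp add: sum.delta)
    have "(\<Sum>k\<in>{1..Z}. if k > 1 then real \<tau> / real (E + 1) * w k else 0) = real \<tau> / real (E + 1) * (\<Sum>k\<in>{1<..Z}. w k)"
      unfolding sum_distrib_left by (intro sum.mono_neutral_cong_right) auto
    also have "\<dots> \<le> real \<tau> / real (E + 1) * 2"
      using sum_powr_le[of 1 Z] s by (intro mult_left_mono) (simp_all add: w_def)
    finally show "(\<Sum>k\<in>{1..Z}. if k > 1 then real \<tau> / real (E + 1) * w k else 0) \<le> real \<tau> / real (E + 1) * 2" .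
    have "(\<Sum>k\<in>{1..Z}. if k > Y then real \<tau> * w k else 0) = real \<tau> * (\<Sum>k\<in>{Y<..Z}. w k)"
      unfolding sum_distrib_left using Y by (intro sum.mono_neutral_cong_right) auto
    also have "\<dots> \<le> real \<tau> * (2 * real Y powr (- 1 / 2))"
      unfolding w_def by (intro mult_left_mono sum_powr_le Y s) auto
    finally show "(\<Sum>k\<in>{1..Z}. if k > Y then real \<tau> * w k else 0) \<le> real \<tau> * (2 * real Y powr (- 1 / 2))" .
  qed
  also have "\<dots> = real \<tau> * (1 + 2 / real (E + 1) + 2 * real Y powr (- 1 / 2))" by (simp add: distrib_left)
  finally show ?thesis .
qed

end

section \<open>The resonance inequality\<close>

lemma harm_le: "n \<ge> 1 \<Longrightarrow> harm n \<le> 1 + ln (real n)"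
  using decseqD[OF decseq_harm_diff_ln, of 0 "n - 1"] by (simp add: harm_def)

lemma norm_dpoly_le:
  assumes s: "\<sigma> \<le> 1" and a: "\<And>n. n \<in> {1..Z} \<Longrightarrow> \<bar>a n\<bar> \<le> K"
  shows "norm (dpoly Z a (Complex \<sigma> t)) \<le> K * (harm Z * real Z powr (1 - \<sigma>))"
proof -
  have "norm (dpoly Z a (Complex \<sigma> t)) \<le> (\<Sum>n\<in>{1..Z}. K * (inverse (real n) * real Z powr (1 - \<sigma>)))"
    unfolding dpoly_def
  proof (rule sum_norm_le)
    fix n assume n: "n \<in> {1..Z}"
    have "norm (of_real (a n) * of_nat n powr (- Complex \<sigma> t)) = \<bar>a n\<bar> * real n powr (- \<sigma>)"
      using n by (simp add: norm_mult norm_powr_real_powr)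
    also have "real n powr (- \<sigma>) = inverse (real n) * real n powr (1 - \<sigma>)"
      using n by (simp add: powr_diff powr_minus field_simps)
    also have "\<bar>a n\<bar> * (inverse (real n) * real n powr (1 - \<sigma>)) \<le> K * (inverse (real n) * real Z powr (1 - \<sigma>))"
      using a[OF n] n s by (intro mult_mono mult_left_mono powr_mono2) auto
    finally show "norm (of_real (a n) * of_nat n powr (- Complex \<sigma> t)) \<le> K * (inverse (real n) * real Z powr (1 - \<sigma>))" .
  qed
  also have "\<dots> = K * (harm Z * real Z powr (1 - \<sigma>))"
    by (simp add: harm_def sum_distrib_left sum_distrib_right mult.assoc)
  finally show ?thesis .
qed

text \<open>Each term has norm at most 1. The count of divisors by \<open>Q\<close> itself is crude
  but affordable, as \<open>Q\<close> will be a small power of \<open>T\<close>.\<close>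

lemma norm_div_poly_le:
  assumes s: "\<sigma> \<ge> 0" and Q: "Q > 0"
  shows "norm (div_poly Q (gtot \<sigma>) (Complex \<sigma> t)) \<le> real Q"
proof -
  have "norm (div_poly Q (gtot \<sigma>) (Complex \<sigma> t)) \<le> (\<Sum>d | d dvd Q. 1)"
    unfolding div_poly_def
  proof (rule sum_norm_le)
    fix d assume "d \<in> {d. d dvd Q}"
    then have d: "d > 0" using Q by (auto intro!: Nat.gr0I)
    have "norm (of_real (gtot \<sigma> d) * of_nat d powr (- Complex \<sigma> t)) = gtot \<sigma> d * real d powr (- \<sigma>)"
      using d gtot_bounds(1)[OF s, of d] by (simp add: norm_mult norm_powr_real_powr)
    also have "\<dots> \<le> real d powr \<sigma> * real d powr (- \<sigma>)" by (intro mult_right_mono gtot_bounds s) auto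
    also have "\<dots> = 1" using d by (simp flip: powr_add)
    finally show "norm (of_real (gtot \<sigma> d) * of_nat d powr (- Complex \<sigma> t)) \<le> 1" .
  qed
  also have "\<dots> = real (card {d. d dvd Q})" by simp
  also have "card {d. d dvd Q} \<le> card {1..Q}"
    using Q by (intro card_mono) (auto simp: Suc_le_eq dvd_imp_le intro!: Nat.gr0I)
  finally show ?thesis by simp
qed

lemma zeta_sum_eq_dpoly: "zeta_sum X s = dpoly X (\<lambda>_. 1) s"
  by (simp add: zeta_sum_def dpoly_def)

lemma deriv_zeta_sum: "deriv (zeta_sum X) s = - dpoly X (\<lambda>n. ln (real n)) s"
  using DERIV_imp_deriv[OF zeta_sum_deriv] by (simp add: dpoly_def)

lemma perturb_product:
  fixes z1 z w1 w :: complex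
  assumes "norm (z1 - w1) \<le> \<epsilon>" "norm (z - w) \<le> \<epsilon>" "norm w1 \<le> W" "norm w \<le> W"
  shows "\<bar>Re (z1 * cnj z) - Re (w1 * cnj w)\<bar> \<le> \<epsilon> * (2 * W + \<epsilon>)"
proof -
  have e: "\<epsilon> \<ge> 0" "W \<ge> 0" using assms norm_ge_zero order_trans by blast+
  have "norm z \<le> W + \<epsilon>" using norm_triangle_sub[of z w] assms by linarith
  have "z1 * cnj z - w1 * cnj w = (z1 - w1) * cnj z + w1 * cnj (z - w)" by (simp add: algebra_simps)
  then have "norm (z1 * cnj z - w1 * cnj w) \<le> norm (z1 - w1) * norm z + norm w1 * norm (z - w)"
    by (metis complex_mod_cnj norm_mult norm_triangle_ineq)
  also have "\<dots> \<le> \<epsilon> * (W + \<epsilon>) + W * \<epsilon>"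
    using assms e \<open>norm z \<le> W + \<epsilon>\<close> by (intro add_mono mult_mono) auto
  also have "\<dots> = \<epsilon> * (2 * W + \<epsilon>)" by (simp add: algebra_simps)
  finally show ?thesis using abs_Re_le_cmod[of "z1 * cnj z - w1 * cnj w"] by simp
qed

text \<open>The assumption \<open>H\<close> is integrated against \<open>\<bar>R\<bar>\<^sup>2\<close>, where \<open>R\<close> is
  \<open>div_poly Q (gtot \<sigma>)\<close>. The weight \<open>\<bar>zeta\<bar>\<^sup>2\<close> implicit in it makes zeros of \<open>zeta\<close> harmless.\<close>

lemma resonance_inequality:
  fixes T \<sigma> M :: real and X Q Y E :: nat
  defines "Z \<equiv> X * Q"
  defines "G \<equiv> 1 + ln (real Z)" and "\<epsilon> \<equiv> 96 * T powr (- 1 / 2)"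
  assumes T: "T \<ge> 4" and X: "real X \<ge> T\<^sup>2" "real (Suc X) \<le> 16 * T\<^sup>2"
    and s: "7 / 8 \<le> \<sigma>" "\<sigma> \<le> 1" and Q: "Q > 0" "Q \<le> X" and M: "M \<ge> 0"
    and E: "\<And>p. prime p \<Longrightarrow> p \<le> Y \<Longrightarrow> p ^ E dvd Q" and Y: "Y \<ge> 1"
    and H: "\<And>t. T / 2 \<le> t \<Longrightarrow> t \<le> T \<Longrightarrow>
       - Re (deriv zeta (Complex \<sigma> t) * cnj (zeta (Complex \<sigma> t))) \<le> M * (norm (zeta (Complex \<sigma> t)))\<^sup>2"
  shows "(1 - 1 / real (E + 1)) * prime_sum Y \<sigma> \<le> M * (1 + 2 / real (E + 1) + 2 * real Y powr (- 1 / 2)) +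
     (M + 1) * (16 * (real Q)\<^sup>2 * G ^ 3 * real Z powr (2 - 2 * \<sigma>) / T +
       (real Q)\<^sup>2 * \<epsilon> * (2 * (G\<^sup>2 * real Z powr (1 - \<sigma>)) + \<epsilon>))"
proof -
  define W where "W = G\<^sup>2 * real Z powr (1 - \<sigma>)"
  define a where "a = conv_coeff X Q (gtot \<sigma>) (\<lambda>_. 1)"
  define b where "b = conv_coeff X Q (gtot \<sigma>) (\<lambda>m. ln (real m))"
  define A where "A t = dpoly Z a (Complex \<sigma> t)" for t
  define B where "B t = dpoly Z b (Complex \<sigma> t)" for t
  define Err where "Err = 8 * (real Q)\<^sup>2 * G ^ 3 * real Z powr (2 - 2 * \<sigma>)"
  define err where "err = (real Q)\<^sup>2 * \<epsilon> * (2 * W + \<epsilon>)"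
  define \<tau> where "\<tau> = real (card {d. d dvd Q})"
  have s0: "\<sigma> \<ge> 0" using s by simp
  have X1: "X \<ge> 1" using Q by simp
  have XZ: "X \<le> Z" "Z \<ge> 1" using Q unfolding Z_def by (cases Q; cases X; simp)+
  have G: "G \<ge> 1" "harm Z \<le> G" "\<And>n. n \<in> {1..Z} \<Longrightarrow> \<bar>ln (real n)\<bar> \<le> G"
    using XZ harm_le[of Z] by (auto simp: G_def intro!: add_increasing)
  have hG: "harm X \<le> G" using harm_mono[OF XZ(1), where 'a = real] G by linarith
  have eps: "\<epsilon> \<ge> 0" by (simp add: \<epsilon>_def)
  have Wn: "W \<ge> 0" by (simp add: W_def)
  have \<tau>1: "\<tau> \<ge> 1"
    using Q card_mono[of "{d. d dvd Q}" "{1}"] by (simp add: \<tau>_def)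
  have W0: "norm (dpoly X (\<lambda>n. c n) (Complex \<sigma> t)) \<le> W" if "\<And>n. n \<in> {1..Z} \<Longrightarrow> \<bar>c n\<bar> \<le> G" for c t
  proof -
    have "norm (dpoly X (\<lambda>n. c n) (Complex \<sigma> t)) \<le> G * (harm X * real X powr (1 - \<sigma>))"
      using that XZ s by (intro norm_dpoly_le) auto
    also have "\<dots> \<le> G * (G * real Z powr (1 - \<sigma>))"
      using XZ hG G s by (intro mult_left_mono mult_mono powr_mono2) auto
    finally show ?thesis by (simp add: W_def power2_eq_square mult.assoc)
  qed
  \<comment> \<open>This is \<open>H\<close> with \<open>zeta\<close> and its derivative replaced by
    partial sums, multiplied by \<open>(norm R)\<^sup>2\<close>. The replacement costs
    \<open>\<epsilon> * (2 * W + \<epsilon>)\<close> once on the left and \<open>M\<close> times on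
    the right; \<open>norm R \<le> Q\<close> bounds the rest.\<close>
  have pt: "Re (B t * cnj (A t)) \<le> M * Re (A t * cnj (A t)) + (M + 1) * err" if t: "t \<in> {T/2..T}" for t
  proof -
    let ?s = "Complex \<sigma> t"
    define w where "w = dpoly X (\<lambda>_. 1) ?s"
    define w1 where "w1 = dpoly X (\<lambda>n. ln (real n)) ?s"
    define R where "R = div_poly Q (gtot \<sigma>) ?s"
    have AB: "A t = w * R" "B t = w1 * R"
      unfolding A_def B_def a_def b_def w_def w1_def R_def Z_def by (simp_all add: dpoly_mult_div_poly[OF Q(1)])
    have z: "norm (zeta ?s - w) \<le> \<epsilon>"
    proof -
      have "norm (zeta ?s - w) \<le> 12 * T powr (- 1 / 2)"
        using zeta_approx[OF T X, of ?s] t s T by (simp add: w_def zeta_sum_eq_dpoly)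
      also have "\<dots> \<le> \<epsilon>" by (simp add: \<epsilon>_def)
      finally show ?thesis .
    qed
    have z1: "norm (deriv zeta ?s - (- w1)) \<le> \<epsilon>"
      using deriv_zeta_approx[OF T X, of ?s] t s T by (simp add: w1_def deriv_zeta_sum \<epsilon>_def)
    have W: "norm w \<le> W" "norm (- w1) \<le> W" using W0 G by (auto simp: w_def w1_def)
    have p1: "\<bar>Re (deriv zeta ?s * cnj (zeta ?s)) - Re (- w1 * cnj w)\<bar> \<le> \<epsilon> * (2 * W + \<epsilon>)"
      by (rule perturb_product[OF z1 z W(2,1)])
    have p2: "\<bar>Re (zeta ?s * cnj (zeta ?s)) - Re (w * cnj w)\<bar> \<le> \<epsilon> * (2 * W + \<epsilon>)"
      by (rule perturb_product[OF z z W(1,1)])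
    have zz: "Re (zeta ?s * cnj (zeta ?s)) = (norm (zeta ?s))\<^sup>2" by (simp add: complex_mult_cnj cmod_power2)
    have "Re (w1 * cnj w) \<le> M * Re (zeta ?s * cnj (zeta ?s)) + \<epsilon> * (2 * W + \<epsilon>)"
      using H[of t] p1 t unfolding zz by simp
    also have "M * Re (zeta ?s * cnj (zeta ?s)) \<le> M * (Re (w * cnj w) + \<epsilon> * (2 * W + \<epsilon>))"
      using p2 M by (intro mult_left_mono) linarith+
    finally have "Re (w1 * cnj w) \<le> M * Re (w * cnj w) + (M + 1) * (\<epsilon> * (2 * W + \<epsilon>))"
      by (simp add: algebra_simps)
    then have "(norm R)\<^sup>2 * Re (w1 * cnj w) \<le> (norm R)\<^sup>2 * (M * Re (w * cnj w) + (M + 1) * (\<epsilon> * (2 * W + \<epsilon>)))"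
      by (rule mult_left_mono) simp
    also have "\<dots> = M * ((norm R)\<^sup>2 * Re (w * cnj w)) + (norm R)\<^sup>2 * ((M + 1) * (\<epsilon> * (2 * W + \<epsilon>)))"
      by (simp add: algebra_simps)
    also have "(norm R)\<^sup>2 * ((M + 1) * (\<epsilon> * (2 * W + \<epsilon>))) \<le> (real Q)\<^sup>2 * ((M + 1) * (\<epsilon> * (2 * W + \<epsilon>)))"
      using norm_div_poly_le[OF s0 Q(1)] M eps Wn
      by (intro mult_right_mono power_mono mult_nonneg_nonneg) (auto simp: R_def)
    also have "\<dots> = (M + 1) * err" by (simp add: err_def)
    finally have *: "(norm R)\<^sup>2 * Re (w1 * cnj w) \<le> M * ((norm R)\<^sup>2 * Re (w * cnj w)) + (M + 1) * err" by simp
    have "Re ((u * R) * cnj (v * R)) = (norm R)\<^sup>2 * Re (u * cnj v)" for u v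
    proof -
      have "(u * R) * cnj (v * R) = of_real ((norm R)\<^sup>2) * (u * cnj v)"
        unfolding complex_norm_square by (simp add: mult_ac)
      moreover have "Re (of_real x * y) = x * Re y" for x y by simp
      ultimately show ?thesis by (simp only:)
    qed
    with * show ?thesis unfolding AB by simp
  qed
  have cont: "continuous_on {T/2..T} A" "continuous_on {T/2..T} B"
    unfolding A_def B_def by (rule continuous_on_dpoly)+
  have "integral {T/2..T} (\<lambda>t. Re (B t * cnj (A t))) \<le> integral {T/2..T} (\<lambda>t. M * Re (A t * cnj (A t)) + (M + 1) * err)"
    using pt cont by (intro integral_le integrable_continuous_interval continuous_intros) auto
  also have "\<dots> = M * integral {T/2..T} (\<lambda>t. Re (A t * cnj (A t))) + (T / 2) * ((M + 1) * err)"
    using T cont by (subst integral_add) (auto intro!: integrable_continuous_interval continuous_intros)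
  finally have int: "integral {T/2..T} (\<lambda>t. Re (B t * cnj (A t))) \<le> M * integral {T/2..T} (\<lambda>t. Re (A t * cnj (A t))) + (T / 2) * ((M + 1) * err)" .
  have gQ: "real (gcd n Q) powr \<sigma> \<le> real Q" for n
  proof -
    have "real (gcd n Q) powr \<sigma> \<le> real (gcd n Q) powr 1" using Q s by (intro powr_mono) (auto simp: Suc_le_eq)
    also have "\<dots> = real (gcd n Q)" by simp
    also have "\<dots> \<le> real Q" using gcd_le2_nat[of Q n] Q by simp
    finally show ?thesis .
  qed
  have ab: "\<bar>a n\<bar> \<le> real Q" "\<bar>b n\<bar> \<le> real Q * G" if n: "n \<in> {1..Z}" for n
  proof -
    have "a n \<le> real (gcd n Q) powr \<sigma> * 1" unfolding a_def using n by (intro conv_gtot_le[OF s0 Q(1)]) auto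
    moreover have "a n \<ge> 0" unfolding a_def by (intro conv_coeff_nonneg gtot_bounds s0) simp
    ultimately show "\<bar>a n\<bar> \<le> real Q" using gQ[of n] by simp
    have "b n \<le> real (gcd n Q) powr \<sigma> * G" unfolding b_def using n G
      by (intro conv_gtot_le[OF s0 Q(1)]) (auto dest: G(3))
    also have "\<dots> \<le> real Q * G" using gQ G by (intro mult_right_mono) auto
    finally have "b n \<le> real Q * G" .
    moreover have "0 \<le> ln (real m)" for m by (cases "m = 0") auto
    then have "b n \<ge> 0" unfolding b_def by (intro conv_coeff_nonneg gtot_bounds s0)
    ultimately show "\<bar>b n\<bar> \<le> real Q * G" by simp
  qed
  have harm2: "(harm Z)\<^sup>2 \<le> G\<^sup>2" using G harm_nonneg by (intro power_mono) auto
  have mvB: "\<bar>integral {T/2..T} (\<lambda>t. Re (B t * cnj (A t))) - (T - T/2) * (\<Sum>n\<in>{1..Z}. b n * a n * real n powr (- 2 * \<sigma>))\<bar> \<le> Err"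
  proof -
    have "\<bar>integral {T/2..T} (\<lambda>t. Re (B t * cnj (A t))) - (T - T/2) * (\<Sum>n\<in>{1..Z}. b n * a n * real n powr (- 2 * \<sigma>))\<bar>
      \<le> 8 * (real Q * G) * real Q * (harm Z)\<^sup>2 * real Z powr (2 - 2 * \<sigma>)"
      unfolding A_def B_def using ab G T s by (intro mean_value_dpoly) auto
    also have "\<dots> \<le> 8 * (real Q * G) * real Q * G\<^sup>2 * real Z powr (2 - 2 * \<sigma>)"
      using harm2 G by (intro mult_right_mono mult_left_mono) auto
    also have "\<dots> = Err" by (simp add: Err_def power2_eq_square power3_eq_cube mult_ac)
    finally show ?thesis .
  qed
  have mvA: "\<bar>integral {T/2..T} (\<lambda>t. Re (A t * cnj (A t))) - (T - T/2) * (\<Sum>n\<in>{1..Z}. a n * a n * real n powr (- 2 * \<sigma>))\<bar> \<le> Err"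
  proof -
    have "\<bar>integral {T/2..T} (\<lambda>t. Re (A t * cnj (A t))) - (T - T/2) * (\<Sum>n\<in>{1..Z}. a n * a n * real n powr (- 2 * \<sigma>))\<bar>
      \<le> 8 * real Q * real Q * (harm Z)\<^sup>2 * real Z powr (2 - 2 * \<sigma>)"
      unfolding A_def using ab T s by (intro mean_value_dpoly) auto
    \<comment> \<open>A factor \<open>G\<close> is given away so that both mean values share the
      error \<open>Err\<close>.\<close>
    also have "\<dots> \<le> 8 * real Q * real Q * G ^ 3 * real Z powr (2 - 2 * \<sigma>)"
      using harm2 power_increasing[of 2 3 G] G(1) by (intro mult_right_mono mult_left_mono) auto
    also have "\<dots> = Err" by (simp add: Err_def power2_eq_square mult_ac)
    finally show ?thesis .
  qed
  define N where "N = (\<Sum>n\<in>{1..Z}. b n * a n * real n powr (- 2 * \<sigma>))"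
  define D where "D = (\<Sum>n\<in>{1..Z}. a n * a n * real n powr (- 2 * \<sigma>))"
  have N: "N \<ge> \<tau> * (1 - 1 / real (E + 1)) * prime_sum Y \<sigma>"
    unfolding N_def a_def b_def Z_def \<tau>_def by (rule numerator_ge[OF s0 Q(1) E Q(2)])
  have D: "D \<le> \<tau> * (1 + 2 / real (E + 1) + 2 * real Y powr (- 1 / 2))"
    unfolding D_def a_def \<tau>_def by (rule denominator_le[OF s0 Q(1) E Y]) (use s in auto)
  have "(T / 2) * N - Err \<le> integral {T/2..T} (\<lambda>t. Re (B t * cnj (A t)))" using mvB by (simp add: N_def)
  also note int
  also have "integral {T/2..T} (\<lambda>t. Re (A t * cnj (A t))) \<le> (T / 2) * D + Err" using mvA by (simp add: D_def)
  finally have "(T / 2) * N - Err \<le> M * ((T / 2) * D + Err) + (T / 2) * ((M + 1) * err)"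
    using M by (simp add: mult_left_mono)
  also have "M * ((T / 2) * D + Err) + (T / 2) * ((M + 1) * err) = (T / 2) * (M * D + (M + 1) * (2 * Err / T + err)) - Err"
    using T by (simp add: field_simps)
  finally have "(T / 2) * N \<le> (T / 2) * (M * D + (M + 1) * (2 * Err / T + err))" by simp
  then have "N \<le> M * D + (M + 1) * (2 * Err / T + err)" using T by simp
  with N have "\<tau> * ((1 - 1 / real (E + 1)) * prime_sum Y \<sigma>) \<le> M * D + (M + 1) * (2 * Err / T + err)" by (simp add: mult.assoc)
  \<comment> \<open>Since \<open>\<tau> \<ge> 1\<close>, the error may be multiplied by
    \<open>\<tau>\<close>, after which \<open>\<tau>\<close> cancels.\<close>
  also have "\<dots> \<le> M * (\<tau> * (1 + 2 / real (E + 1) + 2 * real Y powr (- 1 / 2))) + \<tau> * ((M + 1) * (2 * Err / T + err))"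
  proof (intro add_mono mult_left_mono D M)
    have "0 \<le> (M + 1) * (2 * Err / T + err)"
      using M T G eps Wn by (intro mult_nonneg_nonneg add_nonneg_nonneg) (auto simp: Err_def err_def)
    then show "(M + 1) * (2 * Err / T + err) \<le> \<tau> * ((M + 1) * (2 * Err / T + err))"
      using \<tau>1 by (simp add: mult_le_cancel_right1)
  qed
  also have "\<dots> = \<tau> * (M * (1 + 2 / real (E + 1) + 2 * real Y powr (- 1 / 2)) + (M + 1) * (2 * Err / T + err))"
    by (simp only: distrib_left mult.left_commute)
  finally have "(1 - 1 / real (E + 1)) * prime_sum Y \<sigma> \<le> M * (1 + 2 / real (E + 1) + 2 * real Y powr (- 1 / 2)) + (M + 1) * (2 * Err / T + err)"
    using \<tau>1 by simp
  then show ?thesis by (simp add: Err_def err_def W_def mult.assoc)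
qed

section \<open>Conclusion\<close>

lemma fact_le_power_real:
  fixes l :: real
  assumes Y: "Y \<ge> 1" and YU: "real Y * (real E * l) \<le> U" and l: "ln (real Y) \<le> l"
  shows "real ((fact Y) ^ E :: nat) \<le> exp U"
proof -
  have "ln (real ((fact Y) ^ E :: nat)) = real E * ln (fact Y)" by (simp add: ln_realpow)
  also have "\<dots> \<le> real E * (real Y * l)"
    using ln_fact_le[of Y] l Y mult_left_mono[OF l, of "real Y"] by (intro mult_left_mono) linarith+
  also have "\<dots> \<le> U" using YU by (simp add: mult_ac)
  finally have "exp (ln (real ((fact Y) ^ E :: nat))) \<le> exp U" by (simp only: exp_le_cancel_iff)
  moreover have "real ((fact Y) ^ E :: nat) > 0" by simp
  ultimately show ?thesis by (simp only: exp_ln)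
qed

text \<open>Here \<open>L\<close> stands for \<open>ln (ln T)\<close>. The size of \<open>Y\<close>
  gives \<open>Y powr (A / L) \<ge> exp A * (1 - 4 * A * ln L / L)\<close>, and
  \<open>prime_sum_ge\<close> with \<open>\<delta> = A / L\<close> yields the main term. The power
  \<open>L ^ 4\<close> costs \<open>4 * exp A * ln L\<close>, the constant \<open>C\<close> costs
  \<open>C * exp A\<close>.\<close>

lemma prime_sum_lower:
  assumes A: "A > 0"
  shows "\<exists>K\<ge>0. \<forall>\<^sub>F L in at_top. \<forall>Y. exp L / L ^ 4 \<le> real Y \<longrightarrow>
     prime_sum Y (1 - A / L) \<ge> (exp A - 1) / A * L - K * ln L"
proof -
  obtain C where C: "C \<ge> 0" "\<And>n \<delta>. n \<ge> 1 \<Longrightarrow> \<delta> > 0 \<Longrightarrow> prime_sum n (1 - \<delta>) \<ge> (real n powr \<delta> - 1) / \<delta> - C * real n powr \<delta>"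
    using prime_sum_ge by blast
  define K where "K = exp A * (4 + C)"
  have "\<forall>\<^sub>F L::real in at_top. L \<ge> exp 1" by (rule eventually_ge_at_top)
  moreover have "\<forall>\<^sub>F L::real in at_top. L \<ge> A * C + A" by (rule eventually_ge_at_top)
  moreover have "\<forall>\<^sub>F L::real in at_top. exp L / L ^ 4 \<ge> 1" by real_asymp
  ultimately have "\<forall>\<^sub>F L in at_top. \<forall>Y. exp L / L ^ 4 \<le> real Y \<longrightarrow>
     prime_sum Y (1 - A / L) \<ge> (exp A - 1) / A * L - K * ln L"
  proof eventually_elim
    case (elim L)
    have L0: "L > 0" using elim(1) exp_gt_zero[of 1] by linarith
    have "ln (exp 1) \<le> ln L" using elim(1) by (subst ln_le_cancel_iff) (use L0 in auto)
    then have ln1: "ln L \<ge> 1" by simp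
    \<comment> \<open>This is the coefficient of \<open>v\<close> below; its sign allows a lower
      bound for \<open>v\<close> to be inserted.\<close>
    have CL: "L / A - C \<ge> 0" using elim(2) A by (simp add: field_simps)
    show ?case
    proof (intro allI impI)
      fix Y assume Y: "exp L / L ^ 4 \<le> real Y"
      have Y1: "Y \<ge> 1" using Y elim(3) by linarith
      define v where "v = real Y powr (A / L)"
      have "ln (exp L / L ^ 4) \<le> ln (real Y)" using Y Y1 L0 by (subst ln_le_cancel_iff) auto
      then have "L - 4 * ln L \<le> ln (real Y)" using L0 by (simp add: ln_div ln_realpow)
      then have "A / L * (L - 4 * ln L) \<le> A / L * ln (real Y)" using A L0 by (intro mult_left_mono) auto
      then have "exp (A / L * (L - 4 * ln L)) \<le> v" using Y1 by (simp add: v_def powr_def)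
      moreover have "A / L * (L - 4 * ln L) = A + - (4 * A * ln L / L)" using L0 by (simp add: field_simps)
      moreover have "exp (- (4 * A * ln L / L)) \<ge> 1 + - (4 * A * ln L / L)" by (rule exp_ge_add_one_self)
      ultimately have v: "v \<ge> exp A * (1 - 4 * A * ln L / L)"
        by (simp only: exp_add) (smt (verit) exp_gt_zero mult_left_mono)
      have "prime_sum Y (1 - A / L) \<ge> (v - 1) / (A / L) - C * v"
        unfolding v_def using C(2)[OF Y1, of "A / L"] A L0 by simp
      also have "(v - 1) / (A / L) - C * v = (L / A - C) * v - L / A" using A L0 by (simp add: field_simps)
      also have "(L / A - C) * v - L / A \<ge> (L / A - C) * (exp A * (1 - 4 * A * ln L / L)) - L / A"
        using mult_left_mono[OF v CL] by simp
      also have "(L / A - C) * (exp A * (1 - 4 * A * ln L / L)) - L / A =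
          (exp A - 1) / A * L - 4 * exp A * ln L - C * exp A + C * exp A * (4 * A * ln L / L)"
        using A L0 by (simp add: field_simps)
      also have "\<dots> \<ge> (exp A - 1) / A * L - 4 * exp A * ln L - C * exp A * ln L + 0"
      proof (intro add_mono diff_mono)
        show "C * exp A * ln L \<ge> C * exp A" using ln1 C(1) mult_left_mono[OF ln1, of "C * exp A"] by simp
        show "0 \<le> C * exp A * (4 * A * ln L / L)" using A C(1) L0 ln1
          by (intro mult_nonneg_nonneg divide_nonneg_nonneg order_trans[OF zero_le_one ln1]) auto
      qed auto
      also have "(exp A - 1) / A * L - 4 * exp A * ln L - C * exp A * ln L + 0 = (exp A - 1) / A * L - K * ln L"
        by (simp add: K_def algebra_simps)
      finally show "prime_sum Y (1 - A / L) \<ge> (exp A - 1) / A * L - K * ln L" .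
    qed
  qed
  moreover have "K \<ge> 0" using C by (simp add: K_def)
  ultimately show ?thesis by blast
qed

text \<open>For large \<open>T\<close> the interval from \<open>T / 2\<close> to \<open>T\<close>
  lies in the range of \<open>t\<close>. If the bound failed throughout,
  \<open>resonance_inequality\<close> would apply with \<open>M = c * L - L / ln L\<close>, where
  \<open>L = ln (ln T)\<close>. All its losses amount to \<open>K * ln L + 6 * c + 1\<close>, less
  than \<open>L / ln L\<close> for large \<open>L\<close>; hence the coefficient 1 of the error
  term.\<close>

lemma log_deriv_zeta_lower:
  fixes A \<beta> :: real
  assumes b: "\<beta> < 1" and A: "A > 0"
  shows "\<forall>\<^sub>F T in at_top. \<exists>t. T powr \<beta> \<le> t \<and> t \<le> T \<and>
       zeta (Complex (sigma_A A T) t) \<noteq> 0 \<and>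
       - Re (deriv zeta (Complex (sigma_A A T) t) / zeta (Complex (sigma_A A T) t)) \<ge>
         (exp A - 1) / A * ln (ln T) - ln (ln T) / ln (ln (ln T))"
proof -
  define c where "c = (exp A - 1) / A"
  have c: "c > 0" using A by (simp add: c_def)
  obtain K where K: "K \<ge> 0" and ps: "\<forall>\<^sub>F L in at_top. \<forall>Y. exp L / L ^ 4 \<le> real Y \<longrightarrow> prime_sum Y (1 - A / L) \<ge> c * L - K * ln L"
    using prime_sum_lower[OF A] unfolding c_def by blast
  have lim: "filterlim (\<lambda>T::real. ln (ln T)) at_top at_top" by real_asymp
  \<comment> \<open>The conditions serve, in order, to bound \<open>Q\<close>, to put
    \<open>\<sigma>\<close> near 1, to round \<open>Y\<close> down, to get
    \<open>Y powr (- 1 / 2) \<le> 1 / L\<close>, to reach the contradiction, and to have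
    \<open>M \<ge> 0\<close>.\<close>
  have "\<forall>\<^sub>F L::real in at_top. 100 * (L + 1) \<le> L\<^sup>2" by real_asymp
  moreover have "\<forall>\<^sub>F L::real in at_top. A / L \<le> 1 / 100" using A by real_asymp
  moreover have "\<forall>\<^sub>F L::real in at_top. exp L / L ^ 3 - 1 \<ge> exp L / L ^ 4" by real_asymp
  moreover have "\<forall>\<^sub>F L::real in at_top. exp L / L ^ 4 \<ge> L\<^sup>2" by real_asymp
  moreover have "\<forall>\<^sub>F L::real in at_top. L / ln L > K * ln L + 6 * c + 1" by real_asymp
  moreover have "\<forall>\<^sub>F L::real in at_top. c * L - L / ln L \<ge> 0" using c by real_asymp
  moreover have "\<forall>\<^sub>F L::real in at_top. L \<ge> 3" by (rule eventually_ge_at_top)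
  ultimately have "\<forall>\<^sub>F L::real in at_top. 100 * (L + 1) \<le> L\<^sup>2 \<and> A / L \<le> 1 / 100 \<and> exp L / L ^ 3 - 1 \<ge> exp L / L ^ 4 \<and>
      exp L / L ^ 4 \<ge> L\<^sup>2 \<and> L / ln L > K * ln L + 6 * c + 1 \<and> c * L - L / ln L \<ge> 0 \<and> L \<ge> 3 \<and>
      (\<forall>Y. exp L / L ^ 4 \<le> real Y \<longrightarrow> prime_sum Y (1 - A / L) \<ge> c * L - K * ln L)"
    using ps by eventually_elim blast
  from eventually_compose_filterlim[OF this lim]
  have "\<forall>\<^sub>F T::real in at_top. 100 * (ln (ln T) + 1) \<le> (ln (ln T))\<^sup>2 \<and> A / ln (ln T) \<le> 1 / 100 \<and>
      exp (ln (ln T)) / ln (ln T) ^ 3 - 1 \<ge> exp (ln (ln T)) / ln (ln T) ^ 4 \<and>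
      exp (ln (ln T)) / ln (ln T) ^ 4 \<ge> (ln (ln T))\<^sup>2 \<and> ln (ln T) / ln (ln (ln T)) > K * ln (ln (ln T)) + 6 * c + 1 \<and>
      c * ln (ln T) - ln (ln T) / ln (ln (ln T)) \<ge> 0 \<and> ln (ln T) \<ge> 3 \<and>
      (\<forall>Y. exp (ln (ln T)) / ln (ln T) ^ 4 \<le> real Y \<longrightarrow> prime_sum Y (1 - A / ln (ln T)) \<ge> c * ln (ln T) - K * ln (ln (ln T)))" .
  moreover have "\<forall>\<^sub>F T::real in at_top. T powr \<beta> \<le> T / 2" using b by real_asymp
  moreover have "\<forall>\<^sub>F T::real in at_top. 16 * T\<^sup>2 * T powr (1 / 100) \<le> T powr 3" by real_asymp
  \<comment> \<open>Here \<open>T powr (1 / 50)\<close> stands for \<open>Q\<^sup>2\<close>, and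
    \<open>T powr (3 / 50)\<close> and \<open>T powr (3 / 100)\<close> for the powers of
    \<open>Z \<le> T powr 3\<close> when \<open>1 - \<sigma> \<le> 1 / 100\<close>. All exponents of
    \<open>T\<close> add up to negative numbers.\<close>
  moreover have "\<forall>\<^sub>F T::real in at_top. 16 * T powr (1 / 50) * (1 + 3 * ln T) ^ 3 * T powr (3 / 50) / T +
      T powr (1 / 50) * (96 * T powr (- 1 / 2)) * (2 * ((1 + 3 * ln T)\<^sup>2 * T powr (3 / 100)) + 96 * T powr (- 1 / 2)) \<le> 1 / ln (ln T)" by real_asymp
  moreover have "\<forall>\<^sub>F T::real in at_top. T \<ge> 4" by (rule eventually_ge_at_top)
  ultimately show ?thesis
  proof eventually_elim
    case (elim T)
    define L where "L = ln (ln T)"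
    note e = elim(1)[folded L_def]
    note T = elim(5)
    have L3: "L \<ge> 3" using e by blast
    have "ln (exp 1) < ln T" using T exp_le by (subst ln_less_cancel_iff) auto
    then have expL: "exp L = ln T" by (simp add: L_def)
    have lnL: "ln L \<ge> 0" using L3 by simp
    define \<sigma> where "\<sigma> = 1 - A / L"
    have sig: "sigma_A A T = \<sigma>" by (simp add: sigma_A_def \<sigma>_def L_def)
    have s: "99 / 100 \<le> \<sigma>" "\<sigma> \<le> 1" using e A L3 by (auto simp: \<sigma>_def)
    define E where "E = nat \<lceil>L\<rceil>"
    have E: "L \<le> real E" "real E \<le> L + 1" using L3 by (auto simp: E_def of_nat_nat)
    \<comment> \<open>\<open>ln Q\<close> is at most \<open>Y * E * L\<close>, with \<open>E\<close>
      and \<open>ln Y\<close> about \<open>L\<close> at most. Dividing by \<open>L ^ 3\<close>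
      therefore leaves a small multiple of \<open>exp L = ln T\<close>.\<close>
    define Y where "Y = nat \<lfloor>exp L / L ^ 3\<rfloor>"
    have "exp L / L ^ 3 \<ge> 0" using L3 by simp
    then have Y: "real Y \<le> exp L / L ^ 3" "real Y \<ge> exp L / L ^ 3 - 1" by (auto simp: Y_def of_nat_nat)
    have Y4: "real Y \<ge> exp L / L ^ 4" using Y e by linarith
    have YL: "real Y \<ge> L\<^sup>2" using Y4 e by linarith
    have "L\<^sup>2 > 0" using L3 by simp
    then have Y1: "Y \<ge> 1" using YL by (metis One_nat_def Suc_leI not_gr_zero of_nat_0 not_le)
    define Q where "Q = (fact Y ^ E :: nat)"
    have Q0: "Q > 0" by (simp add: Q_def)
    have "real Q \<le> exp (exp L / 100)"
      unfolding Q_def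
    proof (rule fact_le_power_real[OF Y1, of E L])
      have "real Y * (real E * L) \<le> exp L / L ^ 3 * ((L + 1) * L)"
        using Y(1) E L3 by (intro mult_mono) auto
      also have "\<dots> = exp L * ((L + 1) / L\<^sup>2)" using L3 by (simp add: power3_eq_cube power2_eq_square)
      also have "\<dots> \<le> exp L * (1 / 100)" using e L3 by (intro mult_left_mono) (auto simp: field_simps)
      finally show "real Y * (real E * L) \<le> exp L / 100" by simp
      have "real Y \<le> exp L / 1" using Y(1) L3 by (elim order_trans, intro divide_left_mono) auto
      then have "ln (real Y) \<le> ln (exp L)" using Y1 by (subst ln_le_cancel_iff) auto
      then show "ln (real Y) \<le> L" by simp
    qed
    also have "\<dots> = T powr (1 / 100)" using T by (simp add: expL powr_def)
    finally have Q: "real Q \<le> T powr (1 / 100)" .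
    have Q2: "(real Q)\<^sup>2 \<le> T powr (1 / 50)"
      using power_mono[OF Q, of 2] T by (simp add: power2_eq_square flip: powr_add)
    define X where "X = nat \<lceil>T\<^sup>2\<rceil>"
    have "T\<^sup>2 \<ge> 16" using power_mono[of 4 T 2] T by simp
    then have X: "real X \<ge> T\<^sup>2" "real (Suc X) \<le> 16 * T\<^sup>2"
      by (auto simp: X_def of_nat_nat) linarith+
    have "T powr (1 / 100) \<le> T powr 2" using T by (intro powr_mono) auto
    also have "T powr 2 = T\<^sup>2" using T by simp
    finally have "real Q \<le> real X" using Q X(1) by linarith
    then have QX: "Q \<le> X" by (simp only: of_nat_le_iff)
    define Z where "Z = X * Q"
    have "real Z \<le> 16 * T\<^sup>2 * T powr (1 / 100)" unfolding Z_def of_nat_mult using X Q by (intro mult_mono) auto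
    then have Z3: "real Z \<le> T powr 3" using elim(3) by linarith
    have Z1: "Z \<ge> 1" using Q0 QX by (simp add: Z_def Suc_le_eq)
    define M where "M = c * L - L / ln L"
    have M: "M \<ge> 0" using e by (simp add: M_def)
    have McL: "M \<le> c * L" using L3 lnL by (simp add: M_def)
    show ?case
    proof (rule ccontr)
      assume neg: "\<not> ?case"
      \<comment> \<open>\<open>neg\<close> gives information only where \<open>zeta\<close> is
        nonzero; at a zero both sides are 0.\<close>
      have H: "- Re (deriv zeta (Complex \<sigma> t) * cnj (zeta (Complex \<sigma> t))) \<le> M * (norm (zeta (Complex \<sigma> t)))\<^sup>2"
        if t: "T / 2 \<le> t" "t \<le> T" for t
      proof (cases "zeta (Complex \<sigma> t) = 0")
        case False
        let ?z = "zeta (Complex \<sigma> t)" and ?z1 = "deriv zeta (Complex \<sigma> t)"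
        have "- Re (?z1 / ?z) < M"
          using neg t elim(2) False unfolding sig L_def[symmetric] c_def[symmetric] M_def by force
        then have le: "- Re (?z1 / ?z) * (norm ?z)\<^sup>2 \<le> M * (norm ?z)\<^sup>2" by (intro mult_right_mono) auto
         have "?z1 * cnj ?z = of_real ((norm ?z)\<^sup>2) * (?z1 / ?z)"
          using False by (simp only: complex_norm_square) simp
        moreover have "Re (of_real x * y) = x * Re y" for x y by simp
        ultimately have "Re (?z1 * cnj ?z) = (norm ?z)\<^sup>2 * Re (?z1 / ?z)" by (simp only:)
        with le show ?thesis by (simp only: minus_mult_left mult.commute)
      qed simp
      have Edvd: "p ^ E dvd Q" if "prime p" "p \<le> Y" for p
        using that by (auto simp: Q_def prime_dvd_fact_iff intro!: dvd_power_same)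
      define G where "G = 1 + ln (real Z)"
      define \<epsilon> where "\<epsilon> = 96 * T powr (- 1 / 2)"
      define err where "err = 16 * (real Q)\<^sup>2 * G ^ 3 * real Z powr (2 - 2 * \<sigma>) / T + (real Q)\<^sup>2 * \<epsilon> * (2 * (G\<^sup>2 * real Z powr (1 - \<sigma>)) + \<epsilon>)"
      have "7 / 8 \<le> \<sigma>" using s by simp
      have main: "(1 - 1 / real (E + 1)) * prime_sum Y \<sigma> \<le> M * (1 + 2 / real (E + 1) + 2 * real Y powr (- 1 / 2)) + (M + 1) * err"
        unfolding err_def G_def \<epsilon>_def Z_def
        by (rule resonance_inequality[OF T X \<open>7 / 8 \<le> \<sigma>\<close> s(2) Q0 QX M Edvd Y1 H])
      have G1: "G \<ge> 1" using Z1 by (simp add: G_def)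
      have "ln (real Z) \<le> ln (T powr 3)" using Z3 Z1 T by (subst ln_le_cancel_iff) auto
      then have G3: "G \<le> 1 + 3 * ln T" using T by (simp add: G_def ln_realpow)
      have Zp: "real Z powr a \<le> T powr (3 * b)" if "0 \<le> a" "a \<le> b" for a b
      proof -
        have "real Z powr a \<le> real Z powr b" using Z1 that by (intro powr_mono) auto
        also have "\<dots> \<le> (T powr 3) powr b" using Z3 that by (intro powr_mono2) auto
        finally show ?thesis by (simp only: powr_powr)
      qed
      have za: "real Z powr (2 - 2 * \<sigma>) \<le> T powr (3 / 50)" using Zp[of "2 - 2 * \<sigma>" "1 / 50"] s by simp
      have zb: "real Z powr (1 - \<sigma>) \<le> T powr (3 / 100)" using Zp[of "1 - \<sigma>" "1 / 100"] s by simp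
      have "err \<le> 16 * T powr (1 / 50) * (1 + 3 * ln T) ^ 3 * T powr (3 / 50) / T +
          T powr (1 / 50) * \<epsilon> * (2 * ((1 + 3 * ln T)\<^sup>2 * T powr (3 / 100)) + \<epsilon>)"
        unfolding err_def using Q2 za zb G1 G3 T
        by (intro add_mono divide_right_mono mult_mono power_mono mult_nonneg_nonneg add_nonneg_nonneg) (auto simp: \<epsilon>_def)
      also have "\<dots> \<le> 1 / L" using elim(4) by (simp only: \<epsilon>_def L_def)
      finally have err: "err \<le> 1 / L" .
      have EL: "1 / real (E + 1) \<le> 1 / L" using E L3 by (intro divide_left_mono) auto
      have "real Y powr (- 1 / 2) \<le> (L\<^sup>2) powr (- 1 / 2)" using YL L3 by (intro powr_mono2') auto
      also have "\<dots> = 1 / L" using L3 by (simp add: powr_powr powr_minus_divide flip: powr_numeral)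
      finally have Yp: "real Y powr (- 1 / 2) \<le> 1 / L" .
      have P: "prime_sum Y \<sigma> \<ge> c * L - K * ln L" using e Y4 by (simp add: \<sigma>_def)
      have P0: "prime_sum Y \<sigma> \<ge> 0"
        unfolding prime_sum_def by (intro sum_nonneg mult_nonneg_nonneg) (auto dest: prime_ge_1_nat)
      have "c * L - K * ln L - c \<le> (1 - 1 / L) * (c * L - K * ln L)"
        using L3 K lnL by (simp add: field_simps)
      also have "\<dots> \<le> (1 - 1 / L) * prime_sum Y \<sigma>" using P L3 by (intro mult_left_mono) auto
      also have "\<dots> \<le> (1 - 1 / real (E + 1)) * prime_sum Y \<sigma>" using EL P0 by (intro mult_right_mono) auto
      also note main
      \<comment> \<open>\<open>1 / (E + 1)\<close>, \<open>Y powr (- 1 / 2)\<close> and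
        \<open>err\<close> are each at most \<open>1 / L\<close>. Together they cost
        \<open>(5 * M + 1) / L\<close>, which is bounded because
        \<open>M \<le> c * L\<close>.\<close>
      also have "M * (1 + 2 / real (E + 1) + 2 * real Y powr (- 1 / 2)) + (M + 1) * err \<le> M * (1 + 2 * (1 / L) + 2 * (1 / L)) + (M + 1) * (1 / L)"
      proof (intro add_mono mult_left_mono)
        show "2 / real (E + 1) \<le> 2 * (1 / L)" using EL by simp
      qed (use M Yp err in auto)
      also have "\<dots> = M + (5 * M + 1) / L" by (simp add: algebra_simps add_divide_distrib)
      also have "(5 * M + 1) / L \<le> (5 * (c * L) + L) / L" using McL L3 by (intro divide_right_mono) auto
      also have "\<dots> = 5 * c + 1" using L3 by (simp add: field_simps)
      finally have "L / ln L \<le> K * ln L + 6 * c + 1" by (simp add: M_def)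
      then show False using e by linarith
    qed
  qed
qed

text \<open>The maximum is expressed by a point \<open>t\<close> at which the bound holds; asking
  for \<open>zeta\<close> to be nonzero there keeps the default value \<open>x / 0 = 0\<close> from
  counting. The second part follows from the first by \<open>- Re z \<le> norm z\<close>.\<close>

theorem theorem1:
  fixes A \<beta> :: real
  assumes "0 < \<beta>" and "\<beta> < 1" and "A > 0"
  shows "\<exists>C>0.
    (\<forall>\<^sub>F T in at_top. \<exists>t. T powr \<beta> \<le> t \<and> t \<le> T \<and>
       zeta (Complex (sigma_A A T) t) \<noteq> 0 \<and>
       - Re (deriv zeta (Complex (sigma_A A T) t) / zeta (Complex (sigma_A A T) t)) \<ge>
         (exp A - 1) / A * ln (ln T) - C * (ln (ln T) / ln (ln (ln T)))) \<and>
    (\<forall>\<^sub>F T in at_top. \<exists>t. T powr \<beta> \<le> t \<and> t \<le> T \<and>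
       zeta (Complex (sigma_A A T) t) \<noteq> 0 \<and>
       norm (deriv zeta (Complex (sigma_A A T) t) / zeta (Complex (sigma_A A T) t)) \<ge>
         (exp A - 1) / A * ln (ln T) - C * (ln (ln T) / ln (ln (ln T))))"
proof (intro exI[of _ 1] conjI)
  note * = log_deriv_zeta_lower[OF assms(2,3)]
  show "\<forall>\<^sub>F T in at_top. \<exists>t. T powr \<beta> \<le> t \<and> t \<le> T \<and>
       zeta (Complex (sigma_A A T) t) \<noteq> 0 \<and>
       - Re (deriv zeta (Complex (sigma_A A T) t) / zeta (Complex (sigma_A A T) t)) \<ge>
         (exp A - 1) / A * ln (ln T) - 1 * (ln (ln T) / ln (ln (ln T)))"
    using * by simp
  have "- Re z \<le> norm z" for z using abs_Re_le_cmod[of z] by linarith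
  then show "\<forall>\<^sub>F T in at_top. \<exists>t. T powr \<beta> \<le> t \<and> t \<le> T \<and>
       zeta (Complex (sigma_A A T) t) \<noteq> 0 \<and>
       norm (deriv zeta (Complex (sigma_A A T) t) / zeta (Complex (sigma_A A T) t)) \<ge>
         (exp A - 1) / A * ln (ln T) - 1 * (ln (ln T) / ln (ln (ln T)))"
    unfolding mult_1 using * by (elim eventually_mono) (meson order_trans)
qed simp

end
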